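(* Let $\theta>0$ and consider the continuous Burnside Markov chain on $[0,1]$ with parameter $\theta$: from $x\in[0,1]$, sample independent $Z,Z'\sim \mathrm{Beta}(\frac\theta2,\frac\theta2)$ and move to $y=xZ+(1-x)Z'$. This chain is reversible with stationary distribution $\mathrm{Beta}(\theta,\theta)$. The non-zero eigenvalues are $1$ and $$\lambda_k={}_3F_2\left(-2k,\,2k+2\theta-1,\,\tfrac\theta2;\ \theta,\theta\,\middle|\,1\right),\qquad k=1,2,\dots .$$ An alternative expression for $\lambda_k$ is $$\lambda_k=\mathbb{E}\left[(Z-Z')^{2k}\right],$$ where $Z,Z'$ are two independent $\mathrm{Beta}(\frac\theta2,\frac\theta2)$ random variables. Moreover, the eigenfunctions corresponding to the zero eigenvalues are the Jacobi polynomials associated to the stationary distribution of odd degree, and for every $k=1,2,\dots$ the eigenfunction corresponding to the eigenvalue $\lambda_k$ is the Jacobi polynomial associated to the stationary distribution of degree $2k$.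
   Context: $\mathrm{Beta}(a,b)$ is the probability distribution on $[0,1]$ with density $\frac{x^{a-1}(1-x)^{b-1}}{B(a,b)}$. The chain has the following equivalent description: from $x\in[0,1]$, break $[0,x]$ into countably many pieces by stick-breaking, i.e. take independent $R_1,R_2,\dots\sim\mathrm{Beta}(1,\theta)$ and use pieces of lengths $Y_1=xR_1$ and $Y_j=x(1-R_1)\cdots(1-R_{j-1})R_j$ for $j\ge2$; break $[x,1]$ in the same way, independently; label each piece $0$ or $1$ by independent fair coin flips; and let $y$ be the total length of the pieces labeled $1$. The Markov operator acts by $Kf(x)=\mathbb{E}[f(y)\mid x]$ on $L^2(\pi)$, where $\pi=\mathrm{Beta}(\theta,\theta)$. Eigenvalues and eigenfunctions are those of this operator ($Kf=\beta f$), and the eigenvalue $1$ has the constant eigenfunction. The Jacobi polynomials associated to $\mathrm{Beta}(\theta,\theta)$ are the orthogonal polynomials (one for each degree $0,1,2,\dots$, unique up to scaling) with respect to $\pi$ on $[0,1]$. The hypergeometric notation is ${}_3F_2(a_1,a_2,a_3;b_1,b_2\,|\,x)=\sum_{l\ge0}\frac{(a_1)_l(a_2)_l(a_3)_l}{(b_1)_l(b_2)_l}\frac{x^l}{l!}$, with $(a)_l=a(a+1)\cdots(a+l-1)$ and $(a)_0=1$; here the series terminates at $l=2k$. *)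

theory Defs
  imports "HOL-Probability.Probability" "HOL-Computational_Algebra.Polynomial"
begin

text \<open>
  All measures live on the Borel sets of the reals. The state space of the chain is
  the interval from 0 to 1: this is where the distributions below are concentrated, and the values
  of the transition kernel at other points play no role.
\<close>

definition beta_distribution :: "real \<Rightarrow> real \<Rightarrow> real measure" where
  "beta_distribution a b =
     density lborel
       (\<lambda>x. ennreal (x powr (a - 1) * (1 - x) powr (b - 1) / Beta a b) * indicator {0..1} x)"

text \<open>Joint law of two independent \<open>Beta(\<theta>/2, \<theta>/2)\<close> variables \<open>(Z, Z')\<close>.\<close>

definition beta_pair :: "real \<Rightarrow> (real \<times> real) measure" where
  "beta_pair \<theta> =
     beta_distribution (\<theta> / 2) (\<theta> / 2) \<Otimes>\<^sub>M beta_distribution (\<theta> / 2) (\<theta> / 2)"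

definition burnside_kernel :: "real \<Rightarrow> real \<Rightarrow> real measure" where
  "burnside_kernel \<theta> x = distr (beta_pair \<theta>) borel (\<lambda>(z, z'). x * z + (1 - x) * z')"


definition reversible :: "('a \<Rightarrow> 'a measure) \<Rightarrow> 'a measure \<Rightarrow> bool" where
  "reversible K \<pi> \<longleftrightarrow>
     (\<forall>A\<in>sets \<pi>. \<forall>B\<in>sets \<pi>.
        (\<integral>\<^sup>+x\<in>A. emeasure (K x) B \<partial>\<pi>) = (\<integral>\<^sup>+x\<in>B. emeasure (K x) A \<partial>\<pi>))"

definition stationary_distribution :: "('a \<Rightarrow> 'a measure) \<Rightarrow> 'a measure \<Rightarrow> bool" where
  "stationary_distribution K \<pi> \<longleftrightarrow>
     prob_space \<pi> \<and> (\<forall>A\<in>sets \<pi>. (\<integral>\<^sup>+x. emeasure (K x) A \<partial>\<pi>) = emeasure \<pi> A)"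


definition square_integrable :: "'a measure \<Rightarrow> ('a \<Rightarrow> real) \<Rightarrow> bool" where
  "square_integrable M f \<longleftrightarrow> f \<in> borel_measurable M \<and> integrable M (\<lambda>x. (f x)\<^sup>2)"

text \<open>
  If \<open>\<pi>\<close> is stationary for \<open>K\<close> and \<open>f\<close> is square integrable for \<open>\<pi>\<close>, then \<open>f\<close> is integrable
  for \<open>K x\<close> at \<open>\<pi>\<close>-almost every \<open>x\<close>; the default value 0 of the integral is
  only taken on a null set.
\<close>

definition markov_operator :: "('a \<Rightarrow> 'a measure) \<Rightarrow> ('a \<Rightarrow> real) \<Rightarrow> 'a \<Rightarrow> real" where
  "markov_operator K f x = (\<integral>y. f y \<partial>K x)"

text \<open>
  Elements of \<open>L\<^sup>2(\<pi>)\<close> are represented by square integrable functions, with equality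
  holding \<open>\<pi>\<close>-almost everywhere; an eigenfunction is a nonzero element.
\<close>

definition eigenfunction ::
    "('a \<Rightarrow> 'a measure) \<Rightarrow> 'a measure \<Rightarrow> real \<Rightarrow> ('a \<Rightarrow> real) \<Rightarrow> bool" where
  "eigenfunction K \<pi> \<beta> f \<longleftrightarrow>
     square_integrable \<pi> f \<and> \<not> (AE x in \<pi>. f x = 0) \<and>
     (AE x in \<pi>. markov_operator K f x = \<beta> * f x)"

definition eigenvalue :: "('a \<Rightarrow> 'a measure) \<Rightarrow> 'a measure \<Rightarrow> real \<Rightarrow> bool" where
  "eigenvalue K \<pi> \<beta> \<longleftrightarrow> (\<exists>f. eigenfunction K \<pi> \<beta> f)"

text \<open>Membership of \<open>f\<close> in the closed linear span, in \<open>L\<^sup>2(M)\<close>, of a set \<open>S\<close> of polynomials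
  (all moments of \<open>M\<close> are assumed finite, as is the case for beta distributions).\<close>

definition in_closed_span :: "real measure \<Rightarrow> real poly set \<Rightarrow> (real \<Rightarrow> real) \<Rightarrow> bool" where
  "in_closed_span M S f \<longleftrightarrow>
     square_integrable M f \<and>
     (\<forall>\<epsilon>>0. \<exists>T c. finite T \<and> T \<subseteq> S \<and>
        (\<integral>x. (f x - (\<Sum>p\<in>T. c p * poly p x))\<^sup>2 \<partial>M) < \<epsilon>)"


text \<open>The zero polynomial has degree 0, hence the separate condition that it does not occur.\<close>

definition orthogonal_polynomials :: "real measure \<Rightarrow> (nat \<Rightarrow> real poly) \<Rightarrow> bool" where
  "orthogonal_polynomials M P \<longleftrightarrow>
     (\<forall>n. P n \<noteq> 0 \<and> degree (P n) = n) \<and>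
     (\<forall>m n. m \<noteq> n \<longrightarrow> (\<integral>x. poly (P m) x * poly (P n) x \<partial>M) = 0)"

text \<open>
  Orthogonal polynomials are determined only up to scaling, so \<open>is_jacobi \<theta> n\<close> holds for
  every nonzero multiple of the Jacobi polynomial of degree \<open>n\<close> associated to
  \<open>Beta(\<theta>, \<theta>)\<close>.
\<close>

definition is_jacobi :: "real \<Rightarrow> nat \<Rightarrow> real poly \<Rightarrow> bool" where
  "is_jacobi \<theta> n p \<longleftrightarrow>
     (\<exists>P. orthogonal_polynomials (beta_distribution \<theta> \<theta>) P \<and> p = P n)"


definition hypergeometric_3F2 ::
    "real \<Rightarrow> real \<Rightarrow> real \<Rightarrow> real \<Rightarrow> real \<Rightarrow> real \<Rightarrow> real" where
  "hypergeometric_3F2 a1 a2 a3 b1 b2 x =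
     (\<Sum>l. pochhammer a1 l * pochhammer a2 l * pochhammer a3 l /
           (pochhammer b1 l * pochhammer b2 l) * (x ^ l / fact l))"

definition burnside_lambda :: "real \<Rightarrow> nat \<Rightarrow> real" where
  "burnside_lambda \<theta> k =
     hypergeometric_3F2 (- 2 * real k) (2 * real k + 2 * \<theta> - 1) (\<theta> / 2) \<theta> \<theta> 1"

end

theory Submission
  imports Defs
begin

text \<open>
  The idea is to consider two consecutive states \<open>(x, y)\<close> of the stationary chain and to show that this
  pair is exchangeable. This is plausible since stick-breaking the two halves of \<open>[0, 1]\<close> and
  flipping coins amounts to a Dirichlet vector \<open>(A, B, C, D)\<close> with all parameters \<open>\<theta>/2\<close>, for which
  \<open>x = A + B\<close> and \<open>y = A + C\<close>. The proof does not construct this vector, but computes the joint moments of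
  \<open>(x, y)\<close> from the moments of Beta distributions: the Chu-Vandermonde identity for Pochhammer symbols
  brings them into the form of the Dirichlet moments, which are symmetric (\<open>joint_moment_symmetric\<close>).
  Taking one exponent to be zero, \<open>y\<close> has the same moments as \<open>x\<close>, and as both live on \<open>[0, 1]\<close> they have the
  same law; this is stationarity. Polynomials are dense in \<open>L\<^sup>2\<close> of any probability measure on \<open>[0, 1]\<close>,
  so the symmetry extends to all square integrable functions (\<open>joint_symmetric\<close>), which is reversibility
  on indicators and self-adjointness of the Markov operator in general.
  
  Since \<open>y = x (Z - Z') + Z'\<close>, the operator maps polynomials of degree \<open>n\<close> to polynomials of degree at most
  \<open>n\<close>, and multiplies the leading coefficient by \<open>\<mu>\<^sub>n = \<^bold>E [(Z - Z')\<^sup>n]\<close>. A self-adjoint operator that is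
  triangular in this sense is diagonal in the basis of orthogonal polynomials, with eigenvalues \<open>\<mu>\<^sub>n\<close>
  (\<open>kernel_poly_J\<close>). The odd ones are zero by symmetry. The even ones are positive and strictly decreasing
  because \<open>0 < \<bar>Z - Z'\<bar> < 1\<close> almost surely, so they are pairwise different.
  
  The orthogonal polynomials are known explicitly as \<open>\<^sub>2F\<^sub>1(-n, n + 2\<theta> - 1; \<theta> | x)\<close>; orthogonality is
  the vanishing of an \<open>n\<close>-th finite difference of a polynomial of lower degree. Evaluating the eigenvalue
  equation at \<open>x = 0\<close>, where this polynomial equals 1, gives the \<open>\<^sub>3F\<^sub>2\<close> formula for \<open>\<mu>\<^sub>n\<close>
  (\<open>difference_moment_eq_3F2\<close>).
  
  Finally, an eigenfunction \<open>f\<close> with eigenvalue \<open>\<beta>\<close> satisfies \<open>(\<beta> - \<mu>\<^sub>n) \<langle>f, J\<^sub>n\<rangle> = 0\<close> for all \<open>n\<close>. By completeness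
  of the Jacobi basis there are no other eigenvalues, the eigenspaces for \<open>\<mu>\<^sub>0, \<mu>\<^sub>2, \<mu>\<^sub>4, \<dots>\<close> are
  one-dimensional, and the kernel is the closed span of the Jacobi polynomials of odd degree.
\<close>

section \<open>Square integrable functions\<close>

lemma square_integrable_mult:
  assumes "square_integrable M f" "square_integrable M g"
  shows "integrable M (\<lambda>x. f x * g x)"
proof (rule Bochner_Integration.integrable_bound)
  show "integrable M (\<lambda>x. (f x)\<^sup>2 + (g x)\<^sup>2)" "(\<lambda>x. f x * g x) \<in> borel_measurable M"
    using assms unfolding square_integrable_def by auto
  have "\<bar>a * b\<bar> \<le> a\<^sup>2 + b\<^sup>2" for a b :: real
    using zero_le_power2[of "a + b"] zero_le_power2[of "a - b"] zero_le_power2[of a] zero_le_power2[of b]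
    by (auto simp: power2_sum power2_diff abs_le_iff)
  then show "AE x in M. norm (f x * g x) \<le> norm ((f x)\<^sup>2 + (g x)\<^sup>2)"
    by (auto intro!: AE_I2)
qed

lemma square_integrable_add:
  assumes "square_integrable M f" "square_integrable M g"
  shows "square_integrable M (\<lambda>x. f x + g x)"
  using assms square_integrable_mult[OF assms]
  unfolding square_integrable_def by (auto simp: power2_sum mult.assoc)

lemma square_integrable_cmult:
  assumes "square_integrable M f"
  shows "square_integrable M (\<lambda>x. c * f x)"
  using assms unfolding square_integrable_def by (auto simp: power_mult_distrib)

lemma square_integrable_diff:
  assumes "square_integrable M f" "square_integrable M g"
  shows "square_integrable M (\<lambda>x. f x - g x)"
  using square_integrable_add[OF assms(1) square_integrable_cmult[OF assms(2), of "-1"]] by simp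

lemma square_integrable_dominated:
  assumes "square_integrable M w" "f \<in> borel_measurable M" "AE x in M. \<bar>f x\<bar> \<le> w x"
  shows "square_integrable M f"
  unfolding square_integrable_def
proof
  show "integrable M (\<lambda>x. (f x)\<^sup>2)"
  proof (rule Bochner_Integration.integrable_bound)
    show "integrable M (\<lambda>x. (w x)\<^sup>2)" using assms by (auto simp: square_integrable_def)
    show "AE x in M. norm ((f x)\<^sup>2) \<le> norm ((w x)\<^sup>2)"
      using assms(3) by eventually_elim (use abs_le_square_iff in fastforce)
  qed (use assms in measurable)
qed fact

lemma square_integrable_cong_AE:
  assumes "square_integrable M f" "g \<in> borel_measurable M" "AE x in M. f x = g x"
  shows "square_integrable M g"
proof -
  have "AE x in M. (f x)\<^sup>2 = (g x)\<^sup>2" using assms(3) by eventually_elim simp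
  then show ?thesis
    using assms(1,2) integrable_cong_AE[of "\<lambda>x. (f x)\<^sup>2" M "\<lambda>x. (g x)\<^sup>2"]
    unfolding square_integrable_def by auto
qed

text \<open>
  The quadratic polynomial \<open>t \<mapsto> \<integral>(f + t g)\<^sup>2\<close> is nonnegative, in particular at its minimum.
\<close>

lemma Cauchy_Schwarz_square_integrable:
  assumes f: "square_integrable M f" and g: "square_integrable M g"
  shows "(\<integral>x. f x * g x \<partial>M)\<^sup>2 \<le> (\<integral>x. (f x)\<^sup>2 \<partial>M) * (\<integral>x. (g x)\<^sup>2 \<partial>M)"
proof -
  define A B C where "A = (\<integral>x. (f x)\<^sup>2 \<partial>M)" and "B = (\<integral>x. f x * g x \<partial>M)"
    and "C = (\<integral>x. (g x)\<^sup>2 \<partial>M)"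
  have [simp]: "integrable M (\<lambda>x. (f x)\<^sup>2)" "integrable M (\<lambda>x. (g x)\<^sup>2)" "integrable M (\<lambda>x. f x * g x)"
    using assms square_integrable_mult by (auto simp: square_integrable_def)
  have quad: "0 \<le> A + 2 * t * B + t\<^sup>2 * C" for t
  proof -
    have "0 \<le> (\<integral>x. (f x + t * g x)\<^sup>2 \<partial>M)"
      by simp
    also have "\<dots> = (\<integral>x. (f x)\<^sup>2 + ((2 * t) * (f x * g x) + t\<^sup>2 * (g x)\<^sup>2) \<partial>M)"
      by (intro Bochner_Integration.integral_cong) (auto simp: power2_sum power_mult_distrib)
    also have "\<dots> = A + 2 * t * B + t\<^sup>2 * C"
      unfolding A_def B_def C_def by simp
    finally show ?thesis .
  qed
  have "C \<ge> 0" unfolding C_def by simp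
  have "B\<^sup>2 \<le> A * C"
  proof (cases "C = 0")
    case True
    have "B = 0"
    proof (rule ccontr)
      assume "B \<noteq> 0"
      \<comment> \<open>A nonconstant affine function takes negative values; here it takes the value -1.\<close>
      then show False using quad[of "- (A + 1) / (2 * B)"] True by (simp add: field_simps)
    qed
    then show ?thesis using True by simp
  next
    case False
    with quad[of "- B / C"] \<open>C \<ge> 0\<close> show ?thesis
      by (simp add: field_simps power2_eq_square)
  qed
  then show ?thesis by (simp add: A_def B_def C_def)
qed

text \<open>
  Continuity of the inner product. This is how identities that are checked on polynomials are
  extended to all square integrable functions.
\<close>

lemma tendsto_integral_mult:
  assumes f: "square_integrable M f" and u: "\<And>n. square_integrable M (u n)"
    and g: "square_integrable M g"
    and lim: "(\<lambda>n. \<integral>x. (f x - u n x)\<^sup>2 \<partial>M) \<longlonglongrightarrow> 0"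
  shows "(\<lambda>n. \<integral>x. u n x * g x \<partial>M) \<longlonglongrightarrow> (\<integral>x. f x * g x \<partial>M)"
proof -
  have diff: "(\<integral>x. f x * g x \<partial>M) - (\<integral>x. u n x * g x \<partial>M) = (\<integral>x. (f x - u n x) * g x \<partial>M)" for n
    using square_integrable_mult[OF f g] square_integrable_mult[OF u[of n] g]
    by (simp add: left_diff_distrib)
  have "(\<lambda>n. ((\<integral>x. f x * g x \<partial>M) - (\<integral>x. u n x * g x \<partial>M))\<^sup>2) \<longlonglongrightarrow> 0"
  proof (rule tendsto_sandwich[OF _ _ tendsto_const])
    show "\<forall>\<^sub>F n in sequentially. ((\<integral>x. f x * g x \<partial>M) - (\<integral>x. u n x * g x \<partial>M))\<^sup>2
        \<le> (\<integral>x. (f x - u n x)\<^sup>2 \<partial>M) * (\<integral>x. (g x)\<^sup>2 \<partial>M)"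
      unfolding diff
      by (intro always_eventually allI Cauchy_Schwarz_square_integrable square_integrable_diff f u g)
    show "(\<lambda>n. (\<integral>x. (f x - u n x)\<^sup>2 \<partial>M) * (\<integral>x. (g x)\<^sup>2 \<partial>M)) \<longlonglongrightarrow> 0"
      using tendsto_mult_right[OF lim, of "\<integral>x. (g x)\<^sup>2 \<partial>M"] by simp
  qed auto
  then have "(\<lambda>n. (\<integral>x. f x * g x \<partial>M) - (\<integral>x. u n x * g x \<partial>M)) \<longlonglongrightarrow> 0"
    by (simp add: power_tendsto_0_iff)
  from tendsto_diff[OF tendsto_const[of "\<integral>x. f x * g x \<partial>M"] this] show ?thesis by simp
qed

lemma (in prob_space) square_integrable_abs_integral:
  assumes f: "square_integrable M f"
  shows "integrable M f" "(\<integral>x. \<bar>f x\<bar> \<partial>M)\<^sup>2 \<le> (\<integral>x. (f x)\<^sup>2 \<partial>M)"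
proof -
  have one: "square_integrable M (\<lambda>x. 1)" by (simp add: square_integrable_def)
  show "integrable M f" using square_integrable_mult[OF f one] by simp
  have "square_integrable M (\<lambda>x. \<bar>f x\<bar>)" using f by (auto simp: square_integrable_def)
  from Cauchy_Schwarz_square_integrable[OF this one]
  show "(\<integral>x. \<bar>f x\<bar> \<partial>M)\<^sup>2 \<le> (\<integral>x. (f x)\<^sup>2 \<partial>M)" by (simp add: prob_space)
qed

section \<open>Density of polynomials and the moment problem on the unit interval\<close>

lemma uniform_poly_approximation:
  fixes f :: "real \<Rightarrow> real"
  assumes "continuous_on {a..b} f" "0 < e"
  obtains p :: "real poly" where "\<And>x. a \<le> x \<Longrightarrow> x \<le> b \<Longrightarrow> \<bar>f x - poly p x\<bar> < e"
proof -
  obtain g where g: "real_polynomial_function g" "\<And>x. x \<in> {a..b} \<Longrightarrow> \<bar>f x - g x\<bar> < e"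
    using Stone_Weierstrass_real_polynomial_function[OF compact_Icc assms] by blast
  then obtain c n where gsum: "g = (\<lambda>x. \<Sum>i\<le>n. c i * x ^ i)"
    by (auto simp: real_polynomial_function_iff_sum)
  have "g x = poly (\<Sum>i\<le>n. monom (c i) i) x" for x
    by (simp add: gsum poly_sum poly_monom)
  then show ?thesis using g(2) that[of "\<Sum>i\<le>n. monom (c i) i"] by simp
qed

lemma borel_measurable_poly [measurable]: "poly (p :: real poly) \<in> borel_measurable borel"
  by (intro borel_measurable_continuous_onI continuous_intros)

locale unit_interval_prob = prob_space M for M :: "real measure" +
  assumes sets_eq_borel [measurable_cong, simp]: "sets M = sets borel"
    and AE_unit: "AE x in M. 0 \<le> x \<and> x \<le> 1"
begin

lemma space_eq_UNIV [simp]: "space M = UNIV"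
  using sets_eq_imp_space_eq[OF sets_eq_borel] by simp

lemma prob_UNIV [simp]: "prob UNIV = 1"
  using prob_space by simp

lemma continuous_square_integrable:
  assumes "continuous_on UNIV f"
  shows "square_integrable M f"
proof -
  have "bounded (f ` {0..1})"
    by (intro compact_imp_bounded compact_continuous_image continuous_on_subset[OF assms]) auto
  then have "\<exists>B. \<forall>x\<in>{0..1}. \<bar>f x\<bar> \<le> B"
    by (simp add: bounded_iff)
  then obtain B where B: "\<And>x. x \<in> {0..1} \<Longrightarrow> \<bar>f x\<bar> \<le> B"
    by blast
  have [measurable]: "f \<in> borel_measurable borel"
    using borel_measurable_continuous_onI[OF assms] .
  have "square_integrable M (\<lambda>_. B)" by (simp add: square_integrable_def)
  then show ?thesis
  proof (rule square_integrable_dominated)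
    show "AE x in M. \<bar>f x\<bar> \<le> B" using AE_unit by eventually_elim (use B in auto)
  qed measurable
qed

lemma poly_square_integrable: "square_integrable M (poly p)"
  by (intro continuous_square_integrable continuous_intros)

lemma poly_integrable: "integrable M (poly p)"
  by (rule square_integrable_abs_integral[OF poly_square_integrable])

lemma power_integrable: "integrable M (\<lambda>x. x ^ k)"
proof -
  have "poly (monom 1 k) = (\<lambda>x. x ^ k :: real)" by (auto simp: poly_monom)
  then show ?thesis using poly_integrable[of "monom 1 k"] by simp
qed

text \<open>
  The closure of the polynomials in \<open>L\<^sup>2(M)\<close>. The following lemmas show, step by step, that it contains
  continuous functions, indicators, simple functions and finally everything.
\<close>

definition poly_approximable :: "(real \<Rightarrow> real) \<Rightarrow> bool" where
  "poly_approximable f \<longleftrightarrow>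
     square_integrable M f \<and> (\<forall>e>0. \<exists>p. (\<integral>x. (f x - poly p x)\<^sup>2 \<partial>M) < e)"

text \<open>
  The factor 2 is the price for a triangle inequality between squared norms, which spares square roots
  in all epsilon arguments.
\<close>

lemma integral_square_triangle:
  assumes "square_integrable M f" "square_integrable M g" "square_integrable M h"
  shows "(\<integral>x. (f x - h x)\<^sup>2 \<partial>M) \<le> 2 * (\<integral>x. (f x - g x)\<^sup>2 \<partial>M) + 2 * (\<integral>x. (g x - h x)\<^sup>2 \<partial>M)"
proof -
  have sq: "(a - c)\<^sup>2 \<le> 2 * (a - b)\<^sup>2 + 2 * (b - c)\<^sup>2" for a b c :: real
    using zero_le_power2[of "a - 2 * b + c"] by (simp add: power2_eq_square algebra_simps)
  have i: "integrable M (\<lambda>x. (f x - h x)\<^sup>2)" "integrable M (\<lambda>x. (f x - g x)\<^sup>2)" "integrable M (\<lambda>x. (g x - h x)\<^sup>2)"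
    using assms square_integrable_diff by (auto simp: square_integrable_def)
  have "(\<integral>x. (f x - h x)\<^sup>2 \<partial>M) \<le> (\<integral>x. 2 * (f x - g x)\<^sup>2 + 2 * (g x - h x)\<^sup>2 \<partial>M)"
    by (intro integral_mono) (use i sq in auto)
  then show ?thesis using i by simp
qed

lemma poly_approximable_closed:
  assumes f: "square_integrable M f"
    and near: "\<And>e. e > 0 \<Longrightarrow> \<exists>g. poly_approximable g \<and> (\<integral>x. (f x - g x)\<^sup>2 \<partial>M) < e"
  shows "poly_approximable f"
  unfolding poly_approximable_def
proof (intro conjI allI impI f)
  fix e :: real assume "e > 0"
  then obtain g where g: "poly_approximable g" "(\<integral>x. (f x - g x)\<^sup>2 \<partial>M) < e / 4"
    using near[of "e / 4"] by auto
  then obtain p where p: "(\<integral>x. (g x - poly p x)\<^sup>2 \<partial>M) < e / 4"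
    using \<open>e > 0\<close> unfolding poly_approximable_def by (metis divide_pos_pos zero_less_numeral)
  have "square_integrable M g" using g by (simp add: poly_approximable_def)
  from integral_square_triangle[OF f this poly_square_integrable[of p]] g p
  show "\<exists>p. (\<integral>x. (f x - poly p x)\<^sup>2 \<partial>M) < e" by (intro exI[of _ p]) linarith
qed

lemma poly_approximable_limit:
  assumes u: "\<And>n. poly_approximable (u n)" and f: "f \<in> borel_measurable M"
    and lim: "\<And>x. (\<lambda>n. u n x) \<longlonglongrightarrow> f x"
    and w: "square_integrable M w" and bound: "\<And>n x. \<bar>u n x\<bar> \<le> w x"
  shows "poly_approximable f"
proof (rule poly_approximable_closed)
  have fw: "\<bar>f x\<bar> \<le> w x" for x
    by (rule tendsto_upperbound[OF tendsto_rabs[OF lim]]) (use bound in auto)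
  show "square_integrable M f"
    by (rule square_integrable_dominated[OF w f]) (use fw in auto)
  have um [measurable]: "u n \<in> borel_measurable M" for n
    using u[of n] by (auto simp: poly_approximable_def square_integrable_def)
  have "(\<lambda>n. \<integral>x. (f x - u n x)\<^sup>2 \<partial>M) \<longlonglongrightarrow> (\<integral>x. 0 \<partial>M)"
  proof (rule integral_dominated_convergence[where w = "\<lambda>x. 4 * (w x)\<^sup>2"])
    show "integrable M (\<lambda>x. 4 * (w x)\<^sup>2)" using w by (auto simp: square_integrable_def)
    have "(\<lambda>n. (f x - u n x)\<^sup>2) \<longlonglongrightarrow> (f x - f x)\<^sup>2" for x
      by (intro tendsto_intros lim)
    then show "AE x in M. (\<lambda>n. (f x - u n x)\<^sup>2) \<longlonglongrightarrow> 0" by simp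
    show "AE x in M. norm ((f x - u n x)\<^sup>2) \<le> 4 * (w x)\<^sup>2" for n
    proof (intro AE_I2)
      fix x
      have "\<bar>f x - u n x\<bar> \<le> \<bar>2 * w x\<bar>" using fw[of x] bound[of n x] by linarith
      then have "(f x - u n x)\<^sup>2 \<le> (2 * w x)\<^sup>2" by (simp only: abs_le_square_iff)
      then show "norm ((f x - u n x)\<^sup>2) \<le> 4 * (w x)\<^sup>2" by (simp add: power_mult_distrib)
    qed
  qed (use f um in measurable)
  then show "\<exists>g. poly_approximable g \<and> (\<integral>x. (f x - g x)\<^sup>2 \<partial>M) < e" if "e > 0" for e
    using u order_tendstoD(2)[of _ 0 sequentially e] that
    by (fastforce simp: eventually_sequentially)
qed

lemma poly_approximable_poly: "poly_approximable (poly p)"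
  unfolding poly_approximable_def using poly_square_integrable
  by (auto intro!: exI[of _ p])

lemma poly_approximable_zero: "poly_approximable (\<lambda>x. 0)"
proof -
  have "poly 0 = (\<lambda>x. 0 :: real)" by auto
  then show ?thesis using poly_approximable_poly[of 0] by simp
qed

lemma poly_approximable_add:
  assumes "poly_approximable f" "poly_approximable g"
  shows "poly_approximable (\<lambda>x. f x + g x)"
  unfolding poly_approximable_def
proof (intro conjI allI impI)
  have fg: "square_integrable M f" "square_integrable M g"
    using assms by (auto simp: poly_approximable_def)
  then show "square_integrable M (\<lambda>x. f x + g x)" by (rule square_integrable_add)
  fix e :: real assume "e > 0"
  then have e: "e / 4 > 0" by simp
  obtain p where p: "(\<integral>x. (f x - poly p x)\<^sup>2 \<partial>M) < e / 4"
    using assms(1) e unfolding poly_approximable_def by meson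
  obtain q where q: "(\<integral>x. (g x - poly q x)\<^sup>2 \<partial>M) < e / 4"
    using assms(2) e unfolding poly_approximable_def by meson
  have "(\<integral>x. ((f x - poly p x) - (poly q x - g x))\<^sup>2 \<partial>M) \<le>
      2 * (\<integral>x. ((f x - poly p x) - 0)\<^sup>2 \<partial>M) + 2 * (\<integral>x. (0 - (poly q x - g x))\<^sup>2 \<partial>M)"
    by (intro integral_square_triangle square_integrable_diff fg poly_square_integrable)
       (simp add: square_integrable_def)
  with p q show "\<exists>p. (\<integral>x. (f x + g x - poly p x)\<^sup>2 \<partial>M) < e"
    by (intro exI[of _ "p + q"]) (simp add: algebra_simps)
qed

lemma poly_approximable_cmult:
  assumes "poly_approximable f"
  shows "poly_approximable (\<lambda>x. c * f x)"
  unfolding poly_approximable_def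
proof (intro conjI allI impI)
  have f: "square_integrable M f" using assms by (auto simp: poly_approximable_def)
  then show "square_integrable M (\<lambda>x. c * f x)" by (rule square_integrable_cmult)
  fix e :: real assume "e > 0"
  then have "e / (c\<^sup>2 + 1) > 0" by (simp add: add_nonneg_pos)
  then obtain p where p: "(\<integral>x. (f x - poly p x)\<^sup>2 \<partial>M) < e / (c\<^sup>2 + 1)"
    using assms unfolding poly_approximable_def by meson
  have "(\<integral>x. (c * f x - poly (smult c p) x)\<^sup>2 \<partial>M) = c\<^sup>2 * (\<integral>x. (f x - poly p x)\<^sup>2 \<partial>M)"
    by (simp add: right_diff_distrib[symmetric] power_mult_distrib)
  also have "\<dots> \<le> (c\<^sup>2 + 1) * (\<integral>x. (f x - poly p x)\<^sup>2 \<partial>M)"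
    by (intro mult_right_mono) auto
  also have "\<dots> < e" using p by (simp add: pos_less_divide_eq add_nonneg_pos mult.commute)
  finally show "\<exists>p. (\<integral>x. (c * f x - poly p x)\<^sup>2 \<partial>M) < e" ..
qed

lemma poly_approximable_sum:
  assumes "\<And>i. i \<in> I \<Longrightarrow> poly_approximable (f i)"
  shows "poly_approximable (\<lambda>x. \<Sum>i\<in>I. f i x)"
  using assms
proof (induction I rule: infinite_finite_induct)
  case (insert i I)
  then show ?case using poly_approximable_add[of "f i" "\<lambda>x. \<Sum>i\<in>I. f i x"] by simp
qed (simp_all add: poly_approximable_zero)

lemma poly_approximable_continuous:
  assumes f: "continuous_on UNIV f"
  shows "poly_approximable f"
proof (rule poly_approximable_closed)
  show sf: "square_integrable M f" by (rule continuous_square_integrable[OF f])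
  fix e :: real assume "e > 0"
  \<comment> \<open>A uniform error below \<open>d\<close> gives a squared error of at most \<open>d\<^sup>2 \<le> d \<le> e / 2\<close>.\<close>
  define d where "d = min 1 (e / 2)"
  have d: "d > 0" "d * d \<le> e / 2" using \<open>e > 0\<close>
    by (auto simp: d_def min_def intro: order_trans[OF mult_right_le_one_le])
  obtain p where p: "\<And>x. 0 \<le> x \<Longrightarrow> x \<le> 1 \<Longrightarrow> \<bar>f x - poly p x\<bar> < d"
    using uniform_poly_approximation[OF continuous_on_subset[OF f subset_UNIV] d(1)] by blast
  have "(\<integral>x. (f x - poly p x)\<^sup>2 \<partial>M) \<le> (\<integral>x. d * d \<partial>M)"
  proof (rule integral_mono_AE)
    show "integrable M (\<lambda>x. (f x - poly p x)\<^sup>2)"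
      using square_integrable_diff[OF sf poly_square_integrable[of p]] by (simp add: square_integrable_def)
    show "AE x in M. (f x - poly p x)\<^sup>2 \<le> d * d"
      using AE_unit
    proof eventually_elim
      case (elim x)
      then have "\<bar>f x - poly p x\<bar> \<le> \<bar>d\<bar>" using p[of x] by simp
      then have "(f x - poly p x)\<^sup>2 \<le> d\<^sup>2" by (simp only: abs_le_square_iff)
      then show ?case by (simp add: power2_eq_square)
    qed
  qed auto
  also have "\<dots> < e" using d \<open>e > 0\<close> by (simp add: prob_space)
  finally show "\<exists>g. poly_approximable g \<and> (\<integral>x. (f x - g x)\<^sup>2 \<partial>M) < e"
    using poly_approximable_poly by blast
qed

text \<open>
  Indicators of half-lines are pointwise limits of continuous ramps. Half-lines form an
  intersection-stable generator of the Borel sets, and the sets with approximable indicator are closed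
  under complements and countable disjoint unions, so Dynkin's argument reaches every Borel set.
\<close>

lemma poly_approximable_indicator:
  assumes "A \<in> sets borel"
  shows "poly_approximable (indicator A)"
proof -
  let ?G = "range (\<lambda>a::real. {..a})"
  have one: "square_integrable M (\<lambda>_. 1)" by (simp add: square_integrable_def)
  have "Int_stable ?G" by (auto simp: Int_stable_def)
  moreover have "?G \<subseteq> Pow UNIV" by simp
  moreover have "A \<in> sigma_sets UNIV ?G"
    using assms unfolding borel_eq_atMost by simp
  ultimately show ?thesis
  proof (induction rule: sigma_sets_induct_disjoint)
    case (basic B)
    then obtain a where B: "B = {..a}" by auto
    show ?case
    proof (rule poly_approximable_limit[where u = "\<lambda>n x. max 0 (min 1 (1 - real n * (x - a)))", OF _ _ _ one])
      show "poly_approximable (\<lambda>x. max 0 (min 1 (1 - real n * (x - a))))" for n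
        by (intro poly_approximable_continuous continuous_intros)
      fix x
      show "(\<lambda>n. max 0 (min 1 (1 - real n * (x - a)))) \<longlonglongrightarrow> indicator B x"
      proof (cases "x \<le> a")
        case True
        then have "max 0 (min 1 (1 - real n * (x - a))) = 1" for n
          using mult_nonneg_nonpos[of "real n" "x - a"] by (auto simp: min_def)
        then show ?thesis using True B by simp
      next
        case False
        obtain N where N: "real N > 1 / (x - a)" using reals_Archimedean2 by blast
        have "max 0 (min 1 (1 - real n * (x - a))) = 0" if "n \<ge> N" for n
        proof -
          have "real n > 1 / (x - a)" using N that by linarith
          then have "real n * (x - a) > 1" using False by (simp add: field_simps)
          then show ?thesis by simp
        qed
        then have "\<forall>\<^sub>F n in sequentially. max 0 (min 1 (1 - real n * (x - a))) = 0"
          by (auto simp: eventually_sequentially)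
        then show ?thesis using False B by (simp add: tendsto_eventually)
      qed
    qed (use B in auto)
  next
    case empty
    have "indicator {} = (\<lambda>x. 0 :: real)" by auto
    then show ?case using poly_approximable_zero by simp
  next
    case (compl B)
    have "indicator (UNIV - B) = (\<lambda>x. poly [:1:] x + (-1) * indicator B x :: real)"
      by (auto simp: indicator_def)
    then show ?case
      using poly_approximable_add[OF poly_approximable_poly[of "[:1:]"] poly_approximable_cmult[OF compl(2), of "-1"]]
      by simp
  next
    case (union B)
    have Bm: "B i \<in> sets borel" for i
      using union(2) unfolding borel_eq_atMost by (auto simp: image_subset_iff)
    have part: "(\<Sum>i<n. indicator (B i) x) = (indicator (\<Union>i<n. B i) x :: real)" for n x
      using union(1) by (subst indicator_UN_disjoint) (auto simp: disjoint_family_on_def)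
    show ?case
    proof (rule poly_approximable_limit[where u = "\<lambda>n x. \<Sum>i<n. indicator (B i) x", OF _ _ _ one])
      show "poly_approximable (\<lambda>x. \<Sum>i<n. indicator (B i) x)" for n
        by (rule poly_approximable_sum) (use union in auto)
      show "(\<lambda>n. \<Sum>i<n. indicator (B i) x) \<longlonglongrightarrow> (indicator (\<Union>i. B i) x :: real)" for x
        unfolding part by (rule LIMSEQ_indicator_UN)
      show "\<bar>\<Sum>i<n. indicator (B i) x\<bar> \<le> (1::real)" for n x
        unfolding part by (simp add: indicator_def)
    qed (use Bm in measurable)
  qed
qed

text \<open>
  A measurable function is a limit of simple functions bounded by \<open>2 \<bar>f\<bar>\<close>, so dominated convergence
  applies to the squared distances.
\<close>

lemma poly_approximable_square_integrable:
  assumes f: "square_integrable M f"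
  shows "poly_approximable f"
proof -
  have fm: "f \<in> borel_measurable M" using f by (simp add: square_integrable_def)
  from borel_measurable_implies_sequence_metric[OF fm, of 0]
  obtain s where s: "\<And>i. simple_function M (s i)" "\<And>x. (\<lambda>i. s i x) \<longlonglongrightarrow> f x"
    "\<And>i x. \<bar>s i x\<bar> \<le> 2 * \<bar>f x\<bar>" by auto
  show ?thesis
  proof (rule poly_approximable_limit[where u = s and w = "\<lambda>x. 2 * \<bar>f x\<bar>"])
    show "poly_approximable (s i)" for i
    proof -
      have fin: "finite (range (s i))" and m: "s i \<in> borel_measurable M"
        using s(1)[of i] simple_functionD(1) borel_measurable_simple_function by fastforce+
      have "s i = (\<lambda>x. \<Sum>y\<in>range (s i). y * indicator (s i -` {y}) x)"
      proof
        fix x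
        have "(\<Sum>y\<in>range (s i). y * indicator (s i -` {y}) x) = (\<Sum>y\<in>range (s i). if y = s i x then y else 0)"
          by (intro sum.cong) (auto simp: indicator_def)
        then show "s i x = (\<Sum>y\<in>range (s i). y * indicator (s i -` {y}) x)" using fin by simp
      qed
      moreover have "s i -` {y} \<in> sets borel" for y
        using measurable_sets[OF m, of "{y}"] by simp
      ultimately show ?thesis
        using poly_approximable_sum[of "range (s i)" "\<lambda>y x. y * indicator (s i -` {y}) x"]
          poly_approximable_cmult poly_approximable_indicator by metis
    qed
    show "square_integrable M (\<lambda>x. 2 * \<bar>f x\<bar>)"
      by (rule square_integrable_cmult) (use f in \<open>auto simp: square_integrable_def\<close>)
  qed (use s fm in auto)
qed

lemma poly_dense_sequence:
  assumes "square_integrable M f"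
  obtains p where "(\<lambda>n. \<integral>x. (f x - poly (p n) x)\<^sup>2 \<partial>M) \<longlonglongrightarrow> 0"
proof -
  have "\<exists>p. (\<integral>x. (f x - poly p x)\<^sup>2 \<partial>M) < 1 / real (Suc n)" for n
    using poly_approximable_square_integrable[OF assms] unfolding poly_approximable_def by simp
  then obtain p where p: "\<And>n. (\<integral>x. (f x - poly (p n) x)\<^sup>2 \<partial>M) < 1 / real (Suc n)" by metis
  have "(\<lambda>n. \<integral>x. (f x - poly (p n) x)\<^sup>2 \<partial>M) \<longlonglongrightarrow> 0"
    by (rule tendsto_sandwich[OF _ _ tendsto_const LIMSEQ_inverse_real_of_nat])
       (use p in \<open>auto intro!: always_eventually less_imp_le simp: inverse_eq_divide\<close>)
  with that show ?thesis .
qed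

text \<open>
  Completeness of the polynomials: along polynomials \<open>p\<^sub>n\<close> tending to \<open>f\<close> in mean square,
  \<open>\<integral>f\<^sup>2\<close> is the limit of \<open>\<integral>p\<^sub>n f = 0\<close>.
\<close>

lemma AE_zero_if_orthogonal_to_polys:
  assumes f: "square_integrable M f" and orth: "\<And>p. (\<integral>x. f x * poly p x \<partial>M) = 0"
  shows "AE x in M. f x = 0"
proof -
  obtain p where p: "(\<lambda>n. \<integral>x. (f x - poly (p n) x)\<^sup>2 \<partial>M) \<longlonglongrightarrow> 0"
    using poly_dense_sequence[OF f] .
  have "(\<lambda>n. \<integral>x. poly (p n) x * f x \<partial>M) \<longlonglongrightarrow> (\<integral>x. f x * f x \<partial>M)"
    by (rule tendsto_integral_mult[OF f poly_square_integrable f p])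
  then have "(\<integral>x. f x * f x \<partial>M) = 0"
    using orth by (simp add: mult.commute LIMSEQ_const_iff)
  then show ?thesis
    using integral_nonneg_eq_0_iff_AE[OF square_integrable_mult[OF f f]] by simp
qed

end

text \<open>
  Equal moments give equal integrals of polynomials, hence, by uniform approximation, of all
  continuous functions. Sines and cosines then give equal characteristic functions.
\<close>

lemma moments_determine_unit_interval_prob:
  assumes M: "unit_interval_prob M" and N: "unit_interval_prob N"
    and moments: "\<And>n. (\<integral>x. x ^ n \<partial>M) = (\<integral>x. x ^ n \<partial>N)"
  shows "M = N"
proof -
  interpret M: unit_interval_prob M by fact
  interpret N: unit_interval_prob N by fact
  have poly_eq: "(\<integral>x. poly p x \<partial>M) = (\<integral>x. poly p x \<partial>N)" for p
  proof -
    show ?thesis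
      using M.power_integrable N.power_integrable by (simp add: poly_altdef moments)
  qed
  have cont_eq: "(\<integral>x. f x \<partial>M) = (\<integral>x. f x \<partial>N)" if f: "continuous_on UNIV f" for f :: "real \<Rightarrow> real"
  proof (rule ccontr)
    let ?d = "\<bar>(\<integral>x. f x \<partial>M) - (\<integral>x. f x \<partial>N)\<bar>"
    assume "(\<integral>x. f x \<partial>M) \<noteq> (\<integral>x. f x \<partial>N)"
    then have d: "?d / 2 > 0" by simp
    obtain p where p: "\<And>x. 0 \<le> x \<Longrightarrow> x \<le> 1 \<Longrightarrow> \<bar>f x - poly p x\<bar> < ?d / 2"
      using uniform_poly_approximation[OF continuous_on_subset[OF f subset_UNIV] d] by blast
    have close: "\<bar>(\<integral>x. f x \<partial>L) - (\<integral>x. poly p x \<partial>L)\<bar> < ?d / 2" if "unit_interval_prob L" for L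
    proof -
      interpret L: unit_interval_prob L by fact
      have i: "integrable L f" "integrable L (poly p)"
        using L.square_integrable_abs_integral(1) L.continuous_square_integrable[OF f] L.poly_integrable by auto
      have "\<bar>(\<integral>x. f x \<partial>L) - (\<integral>x. poly p x \<partial>L)\<bar> = \<bar>\<integral>x. f x - poly p x \<partial>L\<bar>"
        using i by simp
      also have "\<dots> \<le> (\<integral>x. \<bar>f x - poly p x\<bar> \<partial>L)"
        by (rule integral_abs_bound)
      also have "\<dots> < (\<integral>x. ?d / 2 \<partial>L)"
      proof (rule L.integral_less_AE_space)
        show "AE x in L. \<bar>f x - poly p x\<bar> < ?d / 2"
          using L.AE_unit by eventually_elim (use p in auto)
        show "emeasure L (space L) \<noteq> 0" using L.emeasure_space_1 by simp
      qed (use i in auto)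
      finally show ?thesis by (simp add: L.prob_space)
    qed
    have "?d \<le> \<bar>(\<integral>x. f x \<partial>M) - (\<integral>x. poly p x \<partial>M)\<bar> + \<bar>(\<integral>x. f x \<partial>N) - (\<integral>x. poly p x \<partial>N)\<bar>"
      unfolding poly_eq[of p] by (rule order_trans[OF _ abs_triangle_ineq4]) simp
    then show False using close[OF M] close[OF N] by simp
  qed
  show ?thesis
  proof (rule Levy_uniqueness)
    have rd: "real_distribution L" if "unit_interval_prob L" for L
    proof -
      interpret L: unit_interval_prob L by fact
      show ?thesis by unfold_locales simp_all
    qed
    show "real_distribution M" "real_distribution N" using rd M N by auto
    have "(\<integral>x. iexp (t * x) \<partial>L) = Complex (\<integral>x. cos (t * x) \<partial>L) (\<integral>x. sin (t * x) \<partial>L)"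
      if "unit_interval_prob L" for L t
    proof -
      interpret L: unit_interval_prob L by fact
      have "integrable L (\<lambda>x. iexp (t * x))"
        by (rule L.integrable_const_bound[where B = 1]) auto
      then show ?thesis
        by (simp add: complex_eq_iff Re_exp Im_exp flip: integral_Re integral_Im)
    qed
    then show "char M = char N"
      unfolding char_def fun_eq_iff using M N
        cont_eq[of "\<lambda>x. cos (t * x)" for t] cont_eq[of "\<lambda>x. sin (t * x)" for t]
      by (simp add: continuous_intros)
  qed
qed

section \<open>Orthogonal polynomials of a measure on the unit interval\<close>

text \<open>
  Without atoms, finite sets are null, so a nonzero polynomial does not vanish almost everywhere and
  polynomials may be identified with their classes in \<open>L\<^sup>2\<close>.
\<close>

locale unit_interval_diffuse = unit_interval_prob +
  assumes no_atoms: "AE x in M. x \<noteq> a"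
begin

lemma poly_eq_zero_if_AE_zero:
  assumes "AE x in M. poly p x = 0"
  shows "p = 0"
proof (rule ccontr)
  assume "p \<noteq> 0"
  then have "finite {x. poly p x = 0}" by (rule poly_roots_finite)
  then have "AE x in M. \<forall>r\<in>{x. poly p x = 0}. x \<noteq> r"
    by (subst AE_finite_all) (auto intro: no_atoms)
  with assms have "AE x in M. False" by eventually_elim auto
  then show False by simp
qed

lemma integrable_mult_poly:
  assumes "square_integrable M f"
  shows "integrable M (\<lambda>x. f x * poly p x)"
  using square_integrable_mult[OF assms poly_square_integrable] .

lemma integrable_poly_mult_poly [simp]: "integrable M (\<lambda>x. poly p x * poly q x)"
  using integrable_mult_poly[OF poly_square_integrable] .

lemma poly_eq_zero_if_self_orthogonal:
  assumes "(\<integral>x. poly p x * poly p x \<partial>M) = 0"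
  shows "p = 0"
proof (rule poly_eq_zero_if_AE_zero)
  show "AE x in M. poly p x = 0"
    using assms integral_nonneg_eq_0_iff_AE[of M "\<lambda>x. poly p x * poly p x"] by simp
qed

end

text \<open>
  Subtracting the multiple of \<open>P (Suc N)\<close> with the right leading coefficient lowers the degree.
\<close>

lemma degree_graded_basis_expansion:
  fixes p :: "'a :: field poly"
  assumes P: "\<And>n. P n \<noteq> 0 \<and> degree (P n) = n" and "degree p \<le> N"
  shows "\<exists>c. p = (\<Sum>n\<le>N. smult (c n) (P n))"
  using assms(2)
proof (induction N arbitrary: p)
  case 0
  obtain a b where ab: "p = [:a:]" "P 0 = [:b:]" "b \<noteq> 0"
    using 0 P[of 0] by (metis degree_0_id le_zero_eq pCons_0_0)
  then show ?case by (intro exI[of _ "\<lambda>_. a / b"]) simp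
next
  case (Suc N)
  define a where "a = coeff p (Suc N) / coeff (P (Suc N)) (Suc N)"
  let ?r = "p - smult a (P (Suc N))"
  have "coeff (P (Suc N)) (Suc N) \<noteq> 0"
    using P[of "Suc N"] by (metis leading_coeff_0_iff)
  then have "coeff ?r (Suc N) = 0" by (simp add: a_def)
  moreover have "degree ?r \<le> Suc N"
    using Suc.prems P[of "Suc N"] by (intro degree_diff_le order_trans[OF degree_smult_le]) auto
  ultimately have "degree ?r \<le> N"
    by (metis eq_zero_or_degree_less degree_0 le0 less_Suc_eq_le)
  from Suc.IH[OF this] obtain c where "?r = (\<Sum>n\<le>N. smult (c n) (P n))" by blast
  then have "p = (\<Sum>n\<le>N. smult (c n) (P n)) + smult a (P (Suc N))"
    by (metis diff_add_cancel)
  also have "(\<Sum>n\<le>N. smult (c n) (P n)) = (\<Sum>n\<le>N. smult ((c(Suc N := a)) n) (P n))"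
    by (intro sum.cong) auto
  finally have "p = (\<Sum>n\<le>Suc N. smult ((c(Suc N := a)) n) (P n))"
    by simp
  then show ?case by blast
qed

context unit_interval_diffuse
begin

context
  fixes P
  assumes P: "orthogonal_polynomials M P"
begin

lemma orthogonal_expansion:
  obtains c where "p = (\<Sum>n\<le>degree p. smult (c n) (P n))"
  using degree_graded_basis_expansion[of P p "degree p"] P
  unfolding orthogonal_polynomials_def by auto

lemma integral_mult_expansion:
  assumes "square_integrable M f"
  shows "(\<integral>x. f x * poly (\<Sum>n\<in>A. smult (c n) (P n)) x \<partial>M) = (\<Sum>n\<in>A. c n * (\<integral>x. f x * poly (P n) x \<partial>M))"
proof -
  have "(\<integral>x. f x * poly (\<Sum>n\<in>A. smult (c n) (P n)) x \<partial>M) = (\<integral>x. (\<Sum>n\<in>A. c n * (f x * poly (P n) x)) \<partial>M)"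
    by (simp add: poly_sum sum_distrib_left mult_ac)
  also have "\<dots> = (\<Sum>n\<in>A. c n * (\<integral>x. f x * poly (P n) x \<partial>M))"
    using integrable_mult_poly[OF assms] by (subst Bochner_Integration.integral_sum) auto
  finally show ?thesis .
qed

lemma orthogonal_to_lower_degree:
  assumes "degree q < n"
  shows "(\<integral>x. poly (P n) x * poly q x \<partial>M) = 0"
proof -
  obtain c where c: "q = (\<Sum>m\<le>degree q. smult (c m) (P m))" by (rule orthogonal_expansion)
  have "(\<integral>x. poly (P n) x * poly q x \<partial>M) = (\<Sum>m\<le>degree q. c m * (\<integral>x. poly (P n) x * poly (P m) x \<partial>M))"
    by (subst c, rule integral_mult_expansion[OF poly_square_integrable])
  also have "\<dots> = 0"
    using P assms by (intro sum.neutral) (auto simp: orthogonal_polynomials_def)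
  finally show ?thesis .
qed

lemma AE_zero_if_orthogonal_to_basis:
  assumes f: "square_integrable M f" and orth: "\<And>n. (\<integral>x. f x * poly (P n) x \<partial>M) = 0"
  shows "AE x in M. f x = 0"
proof (rule AE_zero_if_orthogonal_to_polys[OF f])
  fix p
  obtain c where c: "p = (\<Sum>m\<le>degree p. smult (c m) (P m))" by (rule orthogonal_expansion)
  show "(\<integral>x. f x * poly p x \<partial>M) = 0"
    by (subst c, subst integral_mult_expansion[OF f]) (simp add: orth)
qed

end

context
  fixes P
  assumes P: "orthogonal_polynomials M P"
begin

text \<open>
  With \<open>c\<close> the quotient of the leading coefficients, the difference \<open>Q n - c P n\<close> has degree below \<open>n\<close>.
  Both \<open>Q n\<close> and \<open>P n\<close> are orthogonal to it, so it is orthogonal to itself.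
\<close>

lemma orthogonal_polynomials_unique:
  assumes Q: "orthogonal_polynomials M Q"
  shows "\<exists>c. c \<noteq> 0 \<and> Q n = smult c (P n)"
proof -
  have PQ: "P n \<noteq> 0" "degree (P n) = n" "Q n \<noteq> 0" "degree (Q n) = n"
    using P Q by (auto simp: orthogonal_polynomials_def)
  define c where "c = coeff (Q n) n / coeff (P n) n"
  have lc: "coeff (P n) n \<noteq> 0" "coeff (Q n) n \<noteq> 0" using PQ by (metis leading_coeff_0_iff)+
  define r where "r = Q n - smult c (P n)"
  have "coeff r n = 0" using lc by (simp add: r_def c_def)
  moreover have "degree r \<le> n" unfolding r_def
    using PQ by (intro degree_diff_le order_trans[OF degree_smult_le]) auto
  ultimately have "r = 0 \<or> degree r < n" using eq_zero_or_degree_less by metis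
  have "r = 0"
  proof (rule disjE[OF \<open>r = 0 \<or> degree r < n\<close>])
    assume *: "degree r < n"
    have "(\<integral>x. poly r x * poly r x \<partial>M) = (\<integral>x. poly (Q n) x * poly r x - c * (poly (P n) x * poly r x) \<partial>M)"
      by (intro Bochner_Integration.integral_cong) (auto simp: r_def algebra_simps)
    also have "\<dots> = 0"
      using orthogonal_to_lower_degree[OF P *] orthogonal_to_lower_degree[OF Q *] by simp
    finally have "(\<integral>x. poly r x * poly r x \<partial>M) = 0" .
    then show "r = 0" by (rule poly_eq_zero_if_self_orthogonal)
  qed
  then have "Q n = smult c (P n)" by (simp add: r_def)
  moreover have "c \<noteq> 0" using lc by (simp add: c_def)
  ultimately show ?thesis by blast
qed

lemma orthogonal_polynomials_rescale:
  assumes "c \<noteq> 0"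
  shows "orthogonal_polynomials M (P(n := smult c (P n)))"
  unfolding orthogonal_polynomials_def
proof (intro conjI allI impI)
  fix k m :: nat
  have PP: "P k \<noteq> 0" "degree (P k) = k" for k using P by (auto simp: orthogonal_polynomials_def)
  then show "(P(n := smult c (P n))) k \<noteq> 0" "degree ((P(n := smult c (P n))) k) = k"
    using assms by auto
  have scaled: "\<exists>d. \<forall>x. poly ((P(n := smult c (P n))) j) x = d * poly (P j) x" for j
  proof (cases "j = n")
    case True
    then show ?thesis by (intro exI[of _ c]) simp
  next
    case False
    then show ?thesis by (intro exI[of _ 1]) simp
  qed
  obtain a b where ab: "\<And>x. poly ((P(n := smult c (P n))) m) x = a * poly (P m) x"
    "\<And>x. poly ((P(n := smult c (P n))) k) x = b * poly (P k) x"
    using scaled[of m] scaled[of k] by metis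
  assume "m \<noteq> k"
  then have "(\<integral>x. poly (P m) x * poly (P k) x \<partial>M) = 0" using P by (simp add: orthogonal_polynomials_def)
  moreover have "(\<integral>x. (a * poly (P m) x) * (b * poly (P k) x) \<partial>M) =
      (\<integral>x. (a * b) * (poly (P m) x * poly (P k) x) \<partial>M)"
    by (intro Bochner_Integration.integral_cong) auto
  ultimately show "(\<integral>x. poly ((P(n := smult c (P n))) m) x * poly ((P(n := smult c (P n))) k) x \<partial>M) = 0"
    unfolding ab by simp
qed

text \<open>
  Take a polynomial close to \<open>f\<close> and drop its components outside \<open>I\<close>. These are orthogonal to \<open>f\<close> and to the
  components that are kept, so by Pythagoras the distance to \<open>f\<close> does not grow.
\<close>

lemma in_closed_span_if_orthogonal_to_rest:
  assumes f: "square_integrable M f" and orth: "\<And>n. n \<notin> I \<Longrightarrow> (\<integral>x. f x * poly (P n) x \<partial>M) = 0"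
  shows "in_closed_span M (P ` I) f"
  unfolding in_closed_span_def
proof (intro conjI allI impI f)
  fix e :: real assume "e > 0"
  then obtain p where p: "(\<integral>x. (f x - poly p x)\<^sup>2 \<partial>M) < e"
    using poly_approximable_square_integrable[OF f] by (auto simp: poly_approximable_def)
  obtain c where c: "p = (\<Sum>n\<le>degree p. smult (c n) (P n))" by (rule orthogonal_expansion[OF P])
  define s r where "s = (\<Sum>n\<in>{..degree p} \<inter> I. smult (c n) (P n))"
    and "r = (\<Sum>n\<in>{..degree p} - I. smult (c n) (P n))"
  have psr: "p = s + r"
    unfolding s_def r_def by (rule trans[OF c sum.Int_Diff]) simp
  have fs: "square_integrable M (\<lambda>x. f x - poly s x)"
    by (rule square_integrable_diff[OF f poly_square_integrable])
  have "(\<integral>x. (f x - poly s x) * poly r x \<partial>M) = (\<Sum>n\<in>{..degree p} - I. c n * (\<integral>x. (f x - poly s x) * poly (P n) x \<partial>M))"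
    unfolding r_def by (rule integral_mult_expansion[OF P fs])
  also have "\<dots> = 0"
  proof (intro sum.neutral ballI)
    fix n assume n: "n \<in> {..degree p} - I"
    have "(\<integral>x. poly (P n) x * poly s x \<partial>M) = (\<Sum>m\<in>{..degree p} \<inter> I. c m * (\<integral>x. poly (P n) x * poly (P m) x \<partial>M))"
      unfolding s_def by (rule integral_mult_expansion[OF P poly_square_integrable])
    also have "\<dots> = 0"
    proof (intro sum.neutral ballI)
      fix m assume "m \<in> {..degree p} \<inter> I"
      then have "n \<noteq> m" using n by auto
      then show "c m * (\<integral>x. poly (P n) x * poly (P m) x \<partial>M) = 0"
        using P by (simp add: orthogonal_polynomials_def)
    qed
    finally have "(\<integral>x. poly s x * poly (P n) x \<partial>M) = 0" by (simp add: mult.commute)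
    then show "c n * (\<integral>x. (f x - poly s x) * poly (P n) x \<partial>M) = 0"
      using orth[of n] n integrable_mult_poly[OF f] by (simp add: left_diff_distrib)
  qed
  finally have cross: "(\<integral>x. (f x - poly s x) * poly r x \<partial>M) = 0" .
  have "(\<integral>x. (f x - poly p x)\<^sup>2 \<partial>M) =
      (\<integral>x. (f x - poly s x)\<^sup>2 - 2 * ((f x - poly s x) * poly r x) + poly r x * poly r x \<partial>M)"
    by (intro Bochner_Integration.integral_cong) (auto simp: psr power2_eq_square algebra_simps)
  also have "\<dots> = (\<integral>x. (f x - poly s x)\<^sup>2 \<partial>M) + (\<integral>x. poly r x * poly r x \<partial>M)"
    using fs integrable_mult_poly[OF fs] cross by (simp add: square_integrable_def)
  finally have "(\<integral>x. (f x - poly p x)\<^sup>2 \<partial>M) = (\<integral>x. (f x - poly s x)\<^sup>2 \<partial>M) + (\<integral>x. poly r x * poly r x \<partial>M)" .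
  moreover have "0 \<le> (\<integral>x. poly r x * poly r x \<partial>M)" by simp
  ultimately have "(\<integral>x. (f x - poly s x)\<^sup>2 \<partial>M) < e"
    using p by linarith
  moreover have "poly s x = (\<Sum>q\<in>P ` ({..degree p} \<inter> I). c (degree q) * poly q x)" for x
  proof -
    have deg: "degree (P n) = n" for n using P by (simp add: orthogonal_polynomials_def)
    then have "inj_on P A" for A by (metis inj_onI)
    then show ?thesis by (subst sum.reindex) (auto simp: s_def poly_sum deg)
  qed
  ultimately show "\<exists>T c. finite T \<and> T \<subseteq> P ` I \<and> (\<integral>x. (f x - (\<Sum>p\<in>T. c p * poly p x))\<^sup>2 \<partial>M) < e"
    by (intro exI[of _ "P ` ({..degree p} \<inter> I)"] exI[of _ "\<lambda>q. c (degree q)"]) auto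
qed

end

end

section \<open>Beta moments and Jacobi polynomials\<close>

text \<open>
  The alternating binomial sum is, up to sign, the \<open>n\<close>-th finite difference of \<open>g\<close> at 0. Pascal's rule
  reduces it to a sum of lower order over the first difference.
\<close>

lemma alternating_binomial_sum_Suc:
  fixes g :: "nat \<Rightarrow> 'a :: comm_ring_1"
  shows "(\<Sum>k\<le>Suc n. (-1) ^ k * of_nat (Suc n choose k) * g k) =
         (\<Sum>k\<le>n. (-1) ^ k * of_nat (n choose k) * (g k - g (Suc k)))"
proof -
  have "(\<Sum>k\<le>n. (-1) ^ k * of_nat (n choose k) * g k) = (\<Sum>k\<le>Suc n. (-1) ^ k * of_nat (n choose k) * g k)"
    by (simp add: binomial_eq_0)
  also have "\<dots> = g 0 - (\<Sum>k\<le>n. (-1) ^ k * of_nat (n choose Suc k) * g (Suc k))"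
    by (subst sum.atMost_Suc_shift) (simp add: sum_negf)
  finally have shift: "(\<Sum>k\<le>n. (-1) ^ k * of_nat (n choose k) * g k) =
      g 0 - (\<Sum>k\<le>n. (-1) ^ k * of_nat (n choose Suc k) * g (Suc k))" .
  have "(\<Sum>k\<le>Suc n. (-1) ^ k * of_nat (Suc n choose k) * g k) =
      g 0 - (\<Sum>k\<le>n. (-1) ^ k * of_nat (n choose Suc k) * g (Suc k))
        - (\<Sum>k\<le>n. (-1) ^ k * of_nat (n choose k) * g (Suc k))"
    by (subst sum.atMost_Suc_shift)
       (simp add: sum_negf sum_subtractf sum.distrib algebra_simps)
  also have "\<dots> = (\<Sum>k\<le>n. (-1) ^ k * of_nat (n choose k) * (g k - g (Suc k)))"
    by (simp add: shift[symmetric] right_diff_distrib sum_subtractf)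
  finally show ?thesis .
qed

text \<open>
  Each differencing lowers the degree of a polynomial, so that \<open>n\<close> of them annihilate a polynomial of
  degree below \<open>n\<close>.
\<close>

lemma alternating_binomial_sum_poly:
  fixes p :: "real poly"
  assumes "degree p < n"
  shows "(\<Sum>k\<le>n. (-1) ^ k * real (n choose k) * poly p (real k)) = 0"
  using assms
proof (induction n arbitrary: p)
  case (Suc n)
  define r where "r = p - pcompose p [:1, 1:]"
  have deg: "degree (pcompose p [:1, 1:]) = degree p" by (simp add: degree_pcompose)
  have "coeff (pcompose p [:1, 1:]) (degree p) = coeff p (degree p)"
    using lead_coeff_comp[of "[:1, 1:]" p] deg by simp
  then have "coeff r (degree p) = 0" by (simp add: r_def)
  moreover have "degree r \<le> degree p" unfolding r_def by (intro degree_diff_le) (simp_all add: deg)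
  ultimately have "r = 0 \<or> degree r < degree p" using eq_zero_or_degree_less by metis
  then have "(\<Sum>k\<le>n. (-1) ^ k * real (n choose k) * poly r (real k)) = 0"
    using Suc by (elim disjE) auto
  moreover have "poly r (real k) = poly p (real k) - poly p (real (Suc k))" for k
    by (simp add: r_def poly_pcompose add.commute)
  ultimately show ?case by (simp only: alternating_binomial_sum_Suc)
qed simp

lemma pochhammer_as_poly:
  "\<exists>p :: real poly. degree p \<le> k \<and> (\<forall>x. poly p x = pochhammer (c + x) k)"
proof (induction k)
  case 0
  show ?case by (intro exI[of _ 1]) simp
next
  case (Suc k)
  then obtain p where p: "degree p \<le> k" "\<And>x. poly p x = pochhammer (c + x) k" by blast
  have "degree (p * [:c + real k, 1:]) \<le> Suc k"
    using p(1) degree_mult_le[of p "[:c + real k, 1:]"] by simp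
  then show ?case
    by (intro exI[of _ "p * [:c + real k, 1:]"]) (auto simp: p(2) pochhammer_Suc algebra_simps)
qed

lemma pos_not_nonpos_Ints: "(x :: real) > 0 \<Longrightarrow> x \<notin> \<int>\<^sub>\<le>\<^sub>0"
  using nonpos_Ints_nonpos[of x] by auto

lemma Beta_real_pos: "a > 0 \<Longrightarrow> b > 0 \<Longrightarrow> Beta a (b :: real) > 0"
  by (simp add: Beta_def)

lemma Beta_shift_ratio:
  fixes a b :: real
  assumes "a > 0" "b > 0"
  shows "Beta (a + real i) (b + real j) / Beta a b =
         pochhammer a i * pochhammer b j / pochhammer (a + b) (i + j)"
  using assms Gamma_real_pos[of a] Gamma_real_pos[of b] Gamma_real_pos[of "a + b"]
  by (simp add: pochhammer_Gamma pos_not_nonpos_Ints Beta_def add_ac)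

text \<open>
  With the indicator under the coercion, the density is a coerced real function, the form that the
  transfer of real integrals to a density needs.
\<close>

lemma beta_distribution_eq:
  "beta_distribution a b = density lborel
     (\<lambda>x. ennreal (x powr (a - 1) * (1 - x) powr (b - 1) / Beta a b * indicator {0..1} x))"
  unfolding beta_distribution_def
  by (intro arg_cong[where f = "density lborel"] ext) (auto simp: indicator_def)

text \<open>
  Multiplying the density by \<open>x\<^sup>i (1 - x)\<^sup>j\<close> shifts the two parameters by \<open>i\<close> and \<open>j\<close>, so the moment is a
  quotient of Beta functions.
\<close>

lemma beta_moment:
  assumes ab: "a > 0" "b > 0"
  shows "(\<integral>x. x ^ i * (1 - x) ^ j \<partial>beta_distribution a b) =
         pochhammer a i * pochhammer b j / pochhammer (a + b) (i + j)"
proof -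
  have pw: "x powr (a - 1) * x ^ i = x powr (a + real i - 1)" if "x \<ge> 0" for x a :: real and i
  \<comment> \<open>Both sides vanish at 0 even for \<open>i = 0\<close>, because \<open>0 powr s = 0\<close> for every \<open>s\<close>.\<close>
  proof (cases "x = 0")
    case False
    then show ?thesis using that by (simp add: powr_realpow[symmetric] powr_add[symmetric] algebra_simps)
  qed simp
  have "(\<integral>x. x ^ i * (1 - x) ^ j \<partial>beta_distribution a b) =
      (\<integral>x. x powr (a - 1) * (1 - x) powr (b - 1) / Beta a b * indicator {0..1} x * (x ^ i * (1 - x) ^ j) \<partial>lborel)"
    unfolding beta_distribution_eq
    by (rule integral_real_density) (use Beta_real_pos[OF ab] in \<open>auto simp: indicator_def\<close>)
  also have "\<dots> = (\<integral>x. indicator {0..1} x *\<^sub>R (x powr (a + real i - 1) * (1 - x) powr (b + real j - 1)) / Beta a b \<partial>lborel)"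
  proof (intro Bochner_Integration.integral_cong refl)
    fix x :: real
    show "x powr (a - 1) * (1 - x) powr (b - 1) / Beta a b * indicator {0..1} x * (x ^ i * (1 - x) ^ j) =
        indicator {0..1} x *\<^sub>R (x powr (a + real i - 1) * (1 - x) powr (b + real j - 1)) / Beta a b"
    proof (cases "x \<in> {0..1}")
      case True
      then show ?thesis using pw[of x a i] pw[of "1 - x" b j] by (simp add: field_simps)
    qed simp
  qed
  also have "\<dots> = set_lebesgue_integral lborel {0..1} (\<lambda>x. x powr (a + real i - 1) * (1 - x) powr (b + real j - 1)) / Beta a b"
    by (simp add: set_lebesgue_integral_def)
  also have "set_lebesgue_integral lborel {0..1} (\<lambda>x. x powr (a + real i - 1) * (1 - x) powr (b + real j - 1)) = Beta (a + real i) (b + real j)"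
    using integrable_Beta[of "a + real i" "b + real j"] has_integral_Beta_real[of "a + real i" "b + real j"] ab
    by (subst set_borel_integral_eq_integral) (auto intro: integral_unique)
  finally show ?thesis using Beta_shift_ratio[OF ab] by simp
qed

lemma beta_unit_interval_diffuse:
  assumes ab: "a > 0" "b > 0"
  shows "unit_interval_diffuse (beta_distribution a b)"
proof -
  have nn: "0 \<le> x powr (a - 1) * (1 - x) powr (b - 1) / Beta a b" for x
    using Beta_real_pos[OF ab] by simp
  have "emeasure (beta_distribution a b) (space (beta_distribution a b)) =
      (\<integral>\<^sup>+x. ennreal (x powr (a - 1) * (1 - x) powr (b - 1) / Beta a b) * indicator {0..1} x \<partial>lborel)"
    unfolding beta_distribution_def by (simp add: emeasure_density)
  also have "\<dots> = ennreal (Beta a b / Beta a b)"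
    by (rule nn_integral_has_integral_lebesgue'[OF nn])
       (intro has_integral_divide has_integral_Beta_real ab)
  finally interpret prob_space "beta_distribution a b"
    by (intro prob_spaceI) (use Beta_real_pos[OF ab] in simp)
  show ?thesis
  proof unfold_locales
    show "sets (beta_distribution a b) = sets borel" by (simp add: beta_distribution_def)
    show "AE x in beta_distribution a b. 0 \<le> x \<and> x \<le> 1"
      unfolding beta_distribution_def by (subst AE_density) (auto simp: indicator_def)
    show "AE x in beta_distribution a b. x \<noteq> c" for c
      unfolding beta_distribution_def
      by (subst AE_density) (use AE_lborel_singleton[of c] in \<open>auto elim!: eventually_mono\<close>)
  qed
qed

text \<open>
  The hypergeometric polynomial \<open>\<^sub>2F\<^sub>1(-n, n + 2\<theta> - 1; \<theta> | x)\<close>, which is the Jacobi polynomial normalised to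
  the value 1 at \<open>x = 0\<close>.
\<close>

definition jacobi_poly :: "real \<Rightarrow> nat \<Rightarrow> real poly" where
  "jacobi_poly \<theta> n = (\<Sum>l\<le>n. monom (pochhammer (- real n) l * pochhammer (real n + 2 * \<theta> - 1) l /
                                   (pochhammer \<theta> l * fact l)) l)"

lemma pochhammer_neg_nat_over_fact:
  "pochhammer (- real n) l / fact l = (-1) ^ l * real (n choose l)"
  by (simp add: binomial_gbinomial gbinomial_pochhammer)

text \<open>
  Integrating term by term leaves \<open>\<Sum>\<^sub>l (-1)\<^sup>l (n choose l) q(l)\<close>, where \<open>q(l)\<close> collects the quotients of
  Pochhammer symbols. Two cancellations, \<open>(\<theta>)\<^sub>l\<^sub>+\<^sub>m / (\<theta>)\<^sub>l = (\<theta> + l)\<^sub>m\<close> and, up to a constant,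
  \<open>(n + 2\<theta> - 1)\<^sub>l / (2\<theta>)\<^sub>l\<^sub>+\<^sub>m = (2\<theta> + m + l)\<^sub>n\<^sub>-\<^sub>1\<^sub>-\<^sub>m\<close>, show that \<open>q\<close> is a polynomial of degree at most
  \<open>n - 1\<close> in \<open>l\<close>, so the sum is an \<open>n\<close>-th finite difference that vanishes.
\<close>

lemma jacobi_poly_orthogonal_to_power:
  assumes \<theta>: "\<theta> > 0" and mn: "m < n"
  shows "(\<integral>x. poly (jacobi_poly \<theta> n) x * x ^ m \<partial>beta_distribution \<theta> \<theta>) = 0"
proof -
  interpret unit_interval_diffuse "beta_distribution \<theta> \<theta>"
    by (rule beta_unit_interval_diffuse) (use \<theta> in auto)
  obtain n' where n': "n = Suc n'" using mn by (cases n) auto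
  have pos: "pochhammer \<theta> l > 0" "pochhammer (2 * \<theta>) l > 0" for l
    using \<theta> by (auto intro: pochhammer_pos)
  obtain p where p: "degree p \<le> m" "\<And>x. poly p x = pochhammer (\<theta> + x) m"
    using pochhammer_as_poly by blast
  obtain q where q: "degree q \<le> n' - m" "\<And>x. poly q x = pochhammer (2 * \<theta> + real m + x) (n' - m)"
    using pochhammer_as_poly by blast
  have deg: "degree (p * q) < n"
    using degree_mult_le[of p q] p(1) q(1) mn n' by linarith
  have int: "integrable (beta_distribution \<theta> \<theta>) (\<lambda>x. c * x ^ k)" for c k
    using power_integrable by simp
  have mom: "(\<integral>x. x ^ k \<partial>beta_distribution \<theta> \<theta>) = pochhammer \<theta> k / pochhammer (2 * \<theta>) k" for k
    using beta_moment[of \<theta> \<theta> k 0] \<theta> by simp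
  have "(\<integral>x. poly (jacobi_poly \<theta> n) x * x ^ m \<partial>beta_distribution \<theta> \<theta>) =
      (\<integral>x. (\<Sum>l\<le>n. pochhammer (- real n) l * pochhammer (real n + 2 * \<theta> - 1) l / (pochhammer \<theta> l * fact l) * x ^ (l + m)) \<partial>beta_distribution \<theta> \<theta>)"
    by (simp add: jacobi_poly_def poly_sum poly_monom sum_distrib_right power_add mult.assoc)
  also have "\<dots> = (\<Sum>l\<le>n. pochhammer (- real n) l * pochhammer (real n + 2 * \<theta> - 1) l / (pochhammer \<theta> l * fact l)
        * (pochhammer \<theta> (l + m) / pochhammer (2 * \<theta>) (l + m)))"
    by (subst Bochner_Integration.integral_sum[OF int]) (simp add: mom mult.commute)
  also have "\<dots> = (\<Sum>l\<le>n. (-1) ^ l * real (n choose l) * poly (p * q) (real l) / pochhammer (2 * \<theta>) n')"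
  proof (intro sum.cong refl)
    fix l
    have e1: "pochhammer \<theta> (l + m) = pochhammer \<theta> l * poly p (real l)"
      by (simp add: p(2) pochhammer_product')
    have e2: "pochhammer (2 * \<theta>) (n' + l) = pochhammer (2 * \<theta>) n' * pochhammer (real n + 2 * \<theta> - 1) l"
      using pochhammer_product'[of "2 * \<theta>" n' l] by (simp add: n' add.commute)
    have "n' + l = (l + m) + (n' - m)" using mn n' by simp
    then have e3: "pochhammer (2 * \<theta>) (n' + l) = pochhammer (2 * \<theta>) (l + m) * poly q (real l)"
      by (simp only: q(2) pochhammer_product') (simp add: algebra_simps)
    have "pochhammer (real n + 2 * \<theta> - 1) l / pochhammer (2 * \<theta>) (l + m) = poly q (real l) / pochhammer (2 * \<theta>) n'"
      using e2 e3 pos(2)[of n'] pos(2)[of "l + m"] by (simp add: field_simps)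
    moreover have "pochhammer (- real n) l * pochhammer (real n + 2 * \<theta> - 1) l / (pochhammer \<theta> l * fact l)
        * (pochhammer \<theta> (l + m) / pochhammer (2 * \<theta>) (l + m)) =
        (pochhammer (- real n) l / fact l) * poly p (real l) * (pochhammer (real n + 2 * \<theta> - 1) l / pochhammer (2 * \<theta>) (l + m))"
      using pos(1)[of l] unfolding e1 by simp
    ultimately show "pochhammer (- real n) l * pochhammer (real n + 2 * \<theta> - 1) l / (pochhammer \<theta> l * fact l)
        * (pochhammer \<theta> (l + m) / pochhammer (2 * \<theta>) (l + m)) =
        (-1) ^ l * real (n choose l) * poly (p * q) (real l) / pochhammer (2 * \<theta>) n'"
      by (simp add: pochhammer_neg_nat_over_fact)
  qed
  also have "\<dots> = 0"
    using alternating_binomial_sum_poly[OF deg] by (simp add: sum_divide_distrib[symmetric])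
  finally show ?thesis .
qed

lemma degree_jacobi_poly:
  assumes \<theta>: "\<theta> > 0"
  shows "jacobi_poly \<theta> n \<noteq> 0" "degree (jacobi_poly \<theta> n) = n"
proof -
  have "pochhammer (real n + 2 * \<theta> - 1) n \<noteq> 0"
  proof (cases n)
    case (Suc n')
    then show ?thesis using \<theta> by (intro less_imp_neq[symmetric] pochhammer_pos) simp
  qed simp
  moreover have "pochhammer (- real n) n \<noteq> 0" by (simp add: pochhammer_same)
  moreover have "pochhammer \<theta> n > 0" using \<theta> by (intro pochhammer_pos)
  ultimately have c: "coeff (jacobi_poly \<theta> n) n \<noteq> 0"
    by (simp add: jacobi_poly_def coeff_sum)
  then show "jacobi_poly \<theta> n \<noteq> 0" by auto
  have "degree (jacobi_poly \<theta> n) \<le> n"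
    unfolding jacobi_poly_def by (intro degree_sum_le order_trans[OF degree_monom_le]) auto
  with c show "degree (jacobi_poly \<theta> n) = n" by (intro antisym le_degree)
qed

lemma orthogonal_polynomials_jacobi_poly:
  assumes \<theta>: "\<theta> > 0"
  shows "orthogonal_polynomials (beta_distribution \<theta> \<theta>) (jacobi_poly \<theta>)"
  unfolding orthogonal_polynomials_def
proof (intro conjI allI impI degree_jacobi_poly[OF \<theta>])
  interpret unit_interval_diffuse "beta_distribution \<theta> \<theta>"
    by (rule beta_unit_interval_diffuse) (use \<theta> in auto)
  have low: "(\<integral>x. poly (jacobi_poly \<theta> n) x * poly (jacobi_poly \<theta> m) x \<partial>beta_distribution \<theta> \<theta>) = 0" if "m < n" for m n
  proof -
    let ?c = "coeff (jacobi_poly \<theta> m)"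
    have int: "integrable (beta_distribution \<theta> \<theta>) (\<lambda>x. poly (jacobi_poly \<theta> n) x * x ^ i)" for i
      using integrable_poly_mult_poly[of "jacobi_poly \<theta> n" "monom 1 i"] by (simp add: poly_monom)
    have "(\<integral>x. poly (jacobi_poly \<theta> n) x * poly (jacobi_poly \<theta> m) x \<partial>beta_distribution \<theta> \<theta>) =
        (\<integral>x. (\<Sum>i\<le>m. ?c i * (poly (jacobi_poly \<theta> n) x * x ^ i)) \<partial>beta_distribution \<theta> \<theta>)"
      by (subst (2) poly_altdef) (simp add: degree_jacobi_poly[OF \<theta>] sum_distrib_left mult_ac)
    also have "\<dots> = (\<Sum>i\<le>m. ?c i * (\<integral>x. poly (jacobi_poly \<theta> n) x * x ^ i \<partial>beta_distribution \<theta> \<theta>))"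
      by (subst Bochner_Integration.integral_sum) (auto simp: int)
    also have "\<dots> = 0"
      using that by (intro sum.neutral) (auto simp: jacobi_poly_orthogonal_to_power[OF \<theta>])
    finally show ?thesis .
  qed
  fix m n :: nat assume "m \<noteq> n"
  then show "(\<integral>x. poly (jacobi_poly \<theta> m) x * poly (jacobi_poly \<theta> n) x \<partial>beta_distribution \<theta> \<theta>) = 0"
    using low[of m n] low[of n m] by (cases "m < n") (simp_all add: mult.commute)
qed

lemma is_jacobi_iff:
  assumes \<theta>: "\<theta> > 0"
  shows "is_jacobi \<theta> n p \<longleftrightarrow> (\<exists>c. c \<noteq> 0 \<and> p = smult c (jacobi_poly \<theta> n))"
proof -
  interpret unit_interval_diffuse "beta_distribution \<theta> \<theta>"
    by (rule beta_unit_interval_diffuse) (use \<theta> in auto)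
  note J = orthogonal_polynomials_jacobi_poly[OF \<theta>]
  show ?thesis
  proof
    assume "is_jacobi \<theta> n p"
    then show "\<exists>c. c \<noteq> 0 \<and> p = smult c (jacobi_poly \<theta> n)"
      unfolding is_jacobi_def using orthogonal_polynomials_unique[OF J] by auto
  next
    assume "\<exists>c. c \<noteq> 0 \<and> p = smult c (jacobi_poly \<theta> n)"
    then obtain c where c: "c \<noteq> 0" "p = smult c (jacobi_poly \<theta> n)" by blast
    then show "is_jacobi \<theta> n p"
      unfolding is_jacobi_def
      by (intro exI[of _ "(jacobi_poly \<theta>)(n := smult c (jacobi_poly \<theta> n))"])
         (auto intro: orthogonal_polynomials_rescale[OF J])
  qed
qed

section \<open>Exchangeability of a stationary step\<close>

lemma (in pair_sigma_finite)
  fixes f :: "'a \<Rightarrow> real" and g :: "'b \<Rightarrow> real"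
  assumes f: "integrable M1 f" and g: "integrable M2 g"
  shows integrable_pair_mult: "integrable (M1 \<Otimes>\<^sub>M M2) (\<lambda>w. f (fst w) * g (snd w))"
    and integral_pair_mult: "(\<integral>w. f (fst w) * g (snd w) \<partial>(M1 \<Otimes>\<^sub>M M2)) = (\<integral>x. f x \<partial>M1) * (\<integral>y. g y \<partial>M2)"
proof -
  have [measurable]: "f \<in> borel_measurable M1" "g \<in> borel_measurable M2" using f g by auto
  show i: "integrable (M1 \<Otimes>\<^sub>M M2) (\<lambda>w. f (fst w) * g (snd w))"
    by (rule Fubini_integrable) (use f g in \<open>auto simp: abs_mult\<close>)
  show "(\<integral>w. f (fst w) * g (snd w) \<partial>(M1 \<Otimes>\<^sub>M M2)) = (\<integral>x. f x \<partial>M1) * (\<integral>y. g y \<partial>M2)"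
    by (subst integral_fst'[OF i, symmetric]) simp
qed

lemma square_integrable_distr:
  assumes "Y \<in> measurable N L" "square_integrable (distr N L Y) f"
  shows "square_integrable N (\<lambda>w. f (Y w))"
  using assms unfolding square_integrable_def
  by (auto simp: integrable_distr_eq intro: measurable_compose)

definition burnside_step :: "real \<times> real \<times> real \<Rightarrow> real" where
  "burnside_step = (\<lambda>(x, z, z'). x * z + (1 - x) * z')"

lemma burnside_step_simp [simp]: "burnside_step (x, z, z') = x * z + (1 - x) * z'"
  by (simp add: burnside_step_def)

locale burnside_chain =
  fixes \<theta> :: real
  assumes \<theta>_pos: "\<theta> > 0"
begin

abbreviation stat :: "real measure" where "stat \<equiv> beta_distribution \<theta> \<theta>"
abbreviation half :: "real measure" where "half \<equiv> beta_distribution (\<theta> / 2) (\<theta> / 2)"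
text \<open>
  The law of \<open>(x, z, z')\<close> with \<open>x\<close> stationary. The pair of the first component and \<open>burnside_step\<close>
  consists of two consecutive states of the stationary chain.
\<close>

abbreviation joint :: "(real \<times> real \<times> real) measure" where "joint \<equiv> stat \<Otimes>\<^sub>M beta_pair \<theta>"

sublocale stat: unit_interval_diffuse stat
  by (rule beta_unit_interval_diffuse) (use \<theta>_pos in auto)

sublocale half: unit_interval_diffuse half
  by (rule beta_unit_interval_diffuse) (use \<theta>_pos in auto)

sublocale halves: pair_prob_space half half ..

sublocale pair: prob_space "beta_pair \<theta>"
  unfolding beta_pair_def by (rule halves.prob_space_axioms)

sublocale joint: pair_prob_space stat "beta_pair \<theta>" ..

lemma sets_beta_pair [measurable_cong, simp]: "sets (beta_pair \<theta>) = sets (borel \<Otimes>\<^sub>M borel)"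
  unfolding beta_pair_def by (intro sets_pair_measure_cong) auto

lemma space_beta_pair [simp]: "space (beta_pair \<theta>) = UNIV"
  using sets_eq_imp_space_eq[OF sets_beta_pair] by (simp add: space_pair_measure)

lemma measurable_burnside_step [measurable]:
  "burnside_step \<in> borel_measurable (borel \<Otimes>\<^sub>M (borel \<Otimes>\<^sub>M borel))"
  unfolding burnside_step_def by measurable

lemma AE_beta_pair_unit:
  "AE w in beta_pair \<theta>. 0 \<le> fst w \<and> fst w \<le> 1 \<and> 0 \<le> snd w \<and> snd w \<le> 1"
  unfolding beta_pair_def
proof (rule halves.AE_pair_measure)
  show "AE x in half. AE y in half. 0 \<le> fst (x, y) \<and> fst (x, y) \<le> 1 \<and> 0 \<le> snd (x, y) \<and> snd (x, y) \<le> 1"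
    using half.AE_unit
  proof eventually_elim
    case (elim x)
    show ?case using half.AE_unit by eventually_elim (use elim in auto)
  qed
qed measurable

lemma AE_joint_unit: "AE w in joint. 0 \<le> burnside_step w \<and> burnside_step w \<le> 1"
proof (rule joint.AE_pair_measure)
  show "AE x in stat. AE w in beta_pair \<theta>. 0 \<le> burnside_step (x, w) \<and> burnside_step (x, w) \<le> 1"
    using stat.AE_unit
  proof eventually_elim
    case (elim x)
    show ?case
      using AE_beta_pair_unit
    proof eventually_elim
      case (elim w)
      obtain z z' where w: "w = (z, z')" by force
      have "x * z + (1 - x) * z' \<le> x * 1 + (1 - x) * 1"
        using elim \<open>0 \<le> x \<and> x \<le> 1\<close> by (intro add_mono mult_left_mono) (auto simp: w)
      then show ?case using elim \<open>0 \<le> x \<and> x \<le> 1\<close> by (simp add: w)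
    qed
  qed
qed measurable

definition half_moment :: "nat \<Rightarrow> real" where
  "half_moment n = pochhammer (\<theta> / 2) n / pochhammer \<theta> n"

lemma half_moment_0 [simp]: "half_moment 0 = 1"
  by (simp add: half_moment_def)

lemma integral_half_power: "(\<integral>z. z ^ n \<partial>half) = half_moment n"
  using beta_moment[of "\<theta> / 2" "\<theta> / 2" n 0] \<theta>_pos by (simp add: half_moment_def)

lemma beta_pair_monomial:
  "integrable (beta_pair \<theta>) (\<lambda>w. fst w ^ i * snd w ^ j)"
  "(\<integral>w. fst w ^ i * snd w ^ j \<partial>beta_pair \<theta>) = half_moment i * half_moment j"
  unfolding beta_pair_def
  using halves.integrable_pair_mult[OF half.power_integrable half.power_integrable, of i j]
    halves.integral_pair_mult[OF half.power_integrable half.power_integrable, of i j]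
  by (simp_all add: integral_half_power)

lemma markov_operator_burnside:
  assumes "f \<in> borel_measurable borel"
  shows "markov_operator (burnside_kernel \<theta>) f x = (\<integral>w. f (burnside_step (x, w)) \<partial>beta_pair \<theta>)"
  unfolding markov_operator_def burnside_kernel_def using assms
  by (subst integral_distr) (auto simp: case_prod_beta burnside_step_def)

lemma burnside_step_power:
  "burnside_step (x, w) ^ n = (\<Sum>j\<le>n. real (n choose j) * (x ^ j * (1 - x) ^ (n - j)) * (fst w ^ j * snd w ^ (n - j)))"
  by (cases w) (simp add: binomial_ring power_mult_distrib mult_ac)

lemma integrable_burnside_step_power: "integrable (beta_pair \<theta>) (\<lambda>w. burnside_step (x, w) ^ n)"
  unfolding burnside_step_power using beta_pair_monomial(1) by auto

lemma integral_burnside_step_power: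
  "(\<integral>w. burnside_step (x, w) ^ n \<partial>beta_pair \<theta>) =
    (\<Sum>j\<le>n. real (n choose j) * (x ^ j * (1 - x) ^ (n - j)) * (half_moment j * half_moment (n - j)))"
  unfolding burnside_step_power using beta_pair_monomial by simp

text \<open>
  Chu-Vandermonde applied to \<open>(\<theta> + j)\<^sub>m = ((\<theta>/2 + j) + \<theta>/2)\<^sub>m\<close>. Up to the factor \<open>(2\<theta>)\<^sub>m\<^sub>+\<^sub>n\<close>, the result is
  the moment \<open>\<^bold>E [(A + B)\<^sup>m (A + C)\<^sup>n]\<close> of a Dirichlet vector \<open>(A, B, C, D)\<close> with all parameters \<open>\<theta>/2\<close>. In
  contrast to the left-hand side, it is visibly symmetric in \<open>m\<close> and \<open>n\<close>.
\<close>

lemma pochhammer_half_convolution: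
  "(\<Sum>j\<le>n. real (n choose j) * pochhammer (\<theta> / 2) j * pochhammer (\<theta> / 2) (n - j) * pochhammer (\<theta> + real j) m) =
   (\<Sum>j\<le>n. \<Sum>i\<le>m. real (n choose j) * real (m choose i) * pochhammer (\<theta> / 2) (i + j) *
      pochhammer (\<theta> / 2) (n - j) * pochhammer (\<theta> / 2) (m - i))"
proof (intro sum.cong refl)
  fix j
  have "pochhammer (\<theta> + real j) m = pochhammer ((\<theta> / 2 + real j) + \<theta> / 2) m"
    by (simp add: add_ac)
  also have "\<dots> = (\<Sum>i\<le>m. real (m choose i) * pochhammer (\<theta> / 2 + real j) i * pochhammer (\<theta> / 2) (m - i))"
    by (rule pochhammer_binomial_sum)
  finally have "pochhammer (\<theta> / 2) j * pochhammer (\<theta> + real j) m =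
      (\<Sum>i\<le>m. real (m choose i) * pochhammer (\<theta> / 2) (i + j) * pochhammer (\<theta> / 2) (m - i))"
    by (simp add: sum_distrib_left pochhammer_product' add.commute[of _ j] mult_ac)
  then have "real (n choose j) * pochhammer (\<theta> / 2) (n - j) * (pochhammer (\<theta> / 2) j * pochhammer (\<theta> + real j) m) =
      real (n choose j) * pochhammer (\<theta> / 2) (n - j) *
      (\<Sum>i\<le>m. real (m choose i) * pochhammer (\<theta> / 2) (i + j) * pochhammer (\<theta> / 2) (m - i))"
    by simp
  then show "real (n choose j) * pochhammer (\<theta> / 2) j * pochhammer (\<theta> / 2) (n - j) * pochhammer (\<theta> + real j) m =
      (\<Sum>i\<le>m. real (n choose j) * real (m choose i) * pochhammer (\<theta> / 2) (i + j) *
        pochhammer (\<theta> / 2) (n - j) * pochhammer (\<theta> / 2) (m - i))"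
    by (simp add: sum_distrib_left mult_ac)
qed

lemma integrable_joint_monomial: "integrable joint (\<lambda>w. fst w ^ m * burnside_step w ^ n)"
proof (rule joint.integrable_const_bound[where B = 1])
  have "AE w in joint. 0 \<le> fst w \<and> fst w \<le> 1"
  proof (rule joint.AE_pair_measure)
    show "AE x in stat. AE w in beta_pair \<theta>. 0 \<le> fst (x, w) \<and> fst (x, w) \<le> 1"
      using stat.AE_unit by eventually_elim simp
  qed measurable
  then show "AE w in joint. norm (fst w ^ m * burnside_step w ^ n) \<le> 1"
    using AE_joint_unit
  proof eventually_elim
    case (elim w)
    then show ?case by (simp add: abs_mult mult_le_one power_le_one)
  qed
qed measurable

lemma joint_moment:
  "(\<integral>w. fst w ^ m * burnside_step w ^ n \<partial>joint) =
   (\<Sum>j\<le>n. \<Sum>i\<le>m. real (n choose j) * real (m choose i) * pochhammer (\<theta> / 2) (i + j) *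
      pochhammer (\<theta> / 2) (n - j) * pochhammer (\<theta> / 2) (m - i)) / pochhammer (2 * \<theta>) (m + n)"
proof -
  have int: "integrable stat (\<lambda>x. x ^ i * (1 - x) ^ j)" for i j
  proof -
    have "poly (monom 1 i * [:1, -1:] ^ j) = (\<lambda>x. x ^ i * (1 - x) ^ j :: real)" by (auto simp: poly_monom)
    then show ?thesis using stat.poly_integrable[of "monom 1 i * [:1, -1:] ^ j"] by simp
  qed
  have pos: "pochhammer \<theta> j > 0" for j using \<theta>_pos by (intro pochhammer_pos)
  have "(\<integral>w. fst w ^ m * burnside_step w ^ n \<partial>joint) =
      (\<integral>x. x ^ m * (\<integral>w. burnside_step (x, w) ^ n \<partial>beta_pair \<theta>) \<partial>stat)"
    by (subst joint.integral_fst'[OF integrable_joint_monomial, symmetric]) simp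
  also have "\<dots> = (\<integral>x. (\<Sum>j\<le>n. real (n choose j) * (half_moment j * half_moment (n - j)) * (x ^ (m + j) * (1 - x) ^ (n - j))) \<partial>stat)"
    unfolding integral_burnside_step_power by (simp add: sum_distrib_left power_add mult_ac)
  also have "\<dots> = (\<Sum>j\<le>n. real (n choose j) * (half_moment j * half_moment (n - j)) *
      (pochhammer \<theta> (m + j) * pochhammer \<theta> (n - j) / pochhammer (2 * \<theta>) (m + n)))"
    using beta_moment[OF \<theta>_pos \<theta>_pos] int by simp
  also have "\<dots> = (\<Sum>j\<le>n. real (n choose j) * pochhammer (\<theta> / 2) j * pochhammer (\<theta> / 2) (n - j) * pochhammer (\<theta> + real j) m)
      / pochhammer (2 * \<theta>) (m + n)"
    unfolding sum_divide_distrib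
  proof (intro sum.cong refl)
    fix j
    have "pochhammer \<theta> (m + j) = pochhammer \<theta> j * pochhammer (\<theta> + real j) m"
      by (simp add: pochhammer_product' add.commute[of m])
    then show "real (n choose j) * (half_moment j * half_moment (n - j)) *
        (pochhammer \<theta> (m + j) * pochhammer \<theta> (n - j) / pochhammer (2 * \<theta>) (m + n)) =
        real (n choose j) * pochhammer (\<theta> / 2) j * pochhammer (\<theta> / 2) (n - j) * pochhammer (\<theta> + real j) m
        / pochhammer (2 * \<theta>) (m + n)"
      using pos[of j] pos[of "n - j"] by (simp add: half_moment_def)
  qed
  finally show ?thesis by (simp only: pochhammer_half_convolution)
qed

lemma joint_moment_symmetric:
  "(\<integral>w. fst w ^ m * burnside_step w ^ n \<partial>joint) = (\<integral>w. fst w ^ n * burnside_step w ^ m \<partial>joint)"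
proof -
  have "(\<Sum>j\<le>n. \<Sum>i\<le>m. real (n choose j) * real (m choose i) * pochhammer (\<theta> / 2) (i + j) *
      pochhammer (\<theta> / 2) (n - j) * pochhammer (\<theta> / 2) (m - i)) =
      (\<Sum>i\<le>m. \<Sum>j\<le>n. real (m choose i) * real (n choose j) * pochhammer (\<theta> / 2) (j + i) *
      pochhammer (\<theta> / 2) (m - i) * pochhammer (\<theta> / 2) (n - j))"
    by (subst sum.swap) (simp add: mult_ac add.commute)
  then show ?thesis by (simp only: joint_moment add.commute[of m n])
qed

lemma distr_joint_fst: "distr joint borel fst = stat"
proof -
  have "distr joint borel fst = distr joint stat fst" by (intro distr_cong) auto
  then show ?thesis by (simp add: pair.distr_pair_fst)
qed

text \<open>
  Stationarity: symmetry of the joint moments with one exponent equal to 0 says that a state and its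
  successor have the same moments, and moments determine the law.
\<close>

lemma distr_joint_burnside_step: "distr joint borel burnside_step = stat"
proof (rule moments_determine_unit_interval_prob)
  show "unit_interval_prob stat" ..
  interpret prob_space "distr joint borel burnside_step"
    by (rule joint.prob_space_distr) measurable
  show "unit_interval_prob (distr joint borel burnside_step)"
  proof unfold_locales
    show "AE x in distr joint borel burnside_step. 0 \<le> x \<and> x \<le> 1"
      by (subst AE_distr_iff) (use AE_joint_unit in auto)
  qed simp
  fix n
  have "(\<integral>x. x ^ n \<partial>distr joint borel burnside_step) = (\<integral>w. fst w ^ 0 * burnside_step w ^ n \<partial>joint)"
    by (subst integral_distr) auto
  also have "\<dots> = (\<integral>w. fst w ^ n * burnside_step w ^ 0 \<partial>joint)" by (rule joint_moment_symmetric)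
  also have "\<dots> = (\<integral>x. x ^ n \<partial>distr joint borel fst)"
    by (subst integral_distr) auto
  finally show "(\<integral>x. x ^ n \<partial>distr joint borel burnside_step) = (\<integral>x. x ^ n \<partial>stat)"
    by (simp add: distr_joint_fst)
qed

lemma
  assumes "f \<in> borel_measurable borel"
  shows integral_joint_fst: "(\<integral>w. f (fst w) \<partial>joint) = (\<integral>x. f x \<partial>stat :: real)"
    and integral_joint_step: "(\<integral>w. f (burnside_step w) \<partial>joint) = (\<integral>x. f x \<partial>stat :: real)"
  using integral_distr[of fst joint borel f] integral_distr[of burnside_step joint borel f] assms
  by (simp_all add: distr_joint_fst distr_joint_burnside_step)

lemma
  assumes "square_integrable stat f"
  shows square_integrable_joint_fst: "square_integrable joint (\<lambda>w. f (fst w))"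
    and square_integrable_joint_step: "square_integrable joint (\<lambda>w. f (burnside_step w))"
  using square_integrable_distr[of fst joint borel f] square_integrable_distr[of burnside_step joint borel f] assms
  by (simp_all add: distr_joint_fst distr_joint_burnside_step)

lemma measurable_stat_borel: "square_integrable stat f \<Longrightarrow> f \<in> borel_measurable borel"
  by (simp add: square_integrable_def measurable_cong_sets[OF stat.sets_eq_borel refl])

lemma joint_symmetric_poly:
  "(\<integral>w. poly p (fst w) * poly q (burnside_step w) \<partial>joint) = (\<integral>w. poly q (fst w) * poly p (burnside_step w) \<partial>joint)"
proof -
  have expand: "(\<integral>w. poly p (fst w) * poly q (burnside_step w) \<partial>joint) =
      (\<Sum>i\<le>degree p. \<Sum>j\<le>degree q. coeff p i * coeff q j * (\<integral>w. fst w ^ i * burnside_step w ^ j \<partial>joint))" for p q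
  proof -
    have "(\<integral>w. poly p (fst w) * poly q (burnside_step w) \<partial>joint) =
      (\<integral>w. (\<Sum>i\<le>degree p. \<Sum>j\<le>degree q. coeff p i * coeff q j * (fst w ^ i * burnside_step w ^ j)) \<partial>joint)"
      by (intro Bochner_Integration.integral_cong refl) (simp add: poly_altdef sum_product mult_ac)
    then show ?thesis using integrable_joint_monomial by simp
  qed
  have "(\<Sum>i\<le>degree p. \<Sum>j\<le>degree q. coeff p i * coeff q j * (\<integral>w. fst w ^ i * burnside_step w ^ j \<partial>joint)) =
      (\<Sum>i\<le>degree p. \<Sum>j\<le>degree q. coeff q j * coeff p i * (\<integral>w. fst w ^ j * burnside_step w ^ i \<partial>joint))"
    by (subst joint_moment_symmetric, subst mult.commute[of "coeff p _"]) (rule refl)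
  also have "\<dots> = (\<Sum>j\<le>degree q. \<Sum>i\<le>degree p. coeff q j * coeff p i * (\<integral>w. fst w ^ j * burnside_step w ^ i \<partial>joint))"
    by (rule sum.swap)
  finally show ?thesis unfolding expand .
qed

lemma tendsto_joint_correlation:
  assumes f: "square_integrable stat f" and g: "square_integrable stat g"
    and lim: "(\<lambda>n. \<integral>x. (f x - poly (p n) x)\<^sup>2 \<partial>stat) \<longlonglongrightarrow> 0"
  shows "(\<lambda>n. \<integral>w. poly (p n) (fst w) * g (burnside_step w) \<partial>joint) \<longlonglongrightarrow>
           (\<integral>w. f (fst w) * g (burnside_step w) \<partial>joint)"
    and "(\<lambda>n. \<integral>w. g (fst w) * poly (p n) (burnside_step w) \<partial>joint) \<longlonglongrightarrow>
           (\<integral>w. g (fst w) * f (burnside_step w) \<partial>joint)"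
proof -
  have [measurable]: "f \<in> borel_measurable borel" "g \<in> borel_measurable borel"
    using f g by (auto dest: measurable_stat_borel)
  have sq: "(\<integral>w. (f (fst w) - poly (p n) (fst w))\<^sup>2 \<partial>joint) = (\<integral>x. (f x - poly (p n) x)\<^sup>2 \<partial>stat)"
    "(\<integral>w. (f (burnside_step w) - poly (p n) (burnside_step w))\<^sup>2 \<partial>joint) = (\<integral>x. (f x - poly (p n) x)\<^sup>2 \<partial>stat)" for n
    by (rule integral_joint_fst, measurable) (rule integral_joint_step, measurable)
  show "(\<lambda>n. \<integral>w. poly (p n) (fst w) * g (burnside_step w) \<partial>joint) \<longlonglongrightarrow>
           (\<integral>w. f (fst w) * g (burnside_step w) \<partial>joint)"
    by (rule tendsto_integral_mult)
       (use sq lim in \<open>auto intro!: square_integrable_joint_fst square_integrable_joint_step f g stat.poly_square_integrable\<close>)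
  have "(\<lambda>n. \<integral>w. poly (p n) (burnside_step w) * g (fst w) \<partial>joint) \<longlonglongrightarrow>
           (\<integral>w. f (burnside_step w) * g (fst w) \<partial>joint)"
    by (rule tendsto_integral_mult)
       (use sq lim in \<open>auto intro!: square_integrable_joint_fst square_integrable_joint_step f g stat.poly_square_integrable\<close>)
  then show "(\<lambda>n. \<integral>w. g (fst w) * poly (p n) (burnside_step w) \<partial>joint) \<longlonglongrightarrow>
           (\<integral>w. g (fst w) * f (burnside_step w) \<partial>joint)"
    by (simp add: mult.commute)
qed

text \<open>
  Both components of a stationary step have law \<open>stat\<close>, so the correlation is continuous in \<open>f\<close> and in \<open>g\<close>
  for the norm of \<open>L\<^sup>2\<close>. Approximating first \<open>g\<close> and then \<open>f\<close> by polynomials reduces symmetry to that of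
  the joint moments.
\<close>

lemma joint_symmetric:
  assumes f: "square_integrable stat f" and g: "square_integrable stat g"
  shows "(\<integral>w. f (fst w) * g (burnside_step w) \<partial>joint) = (\<integral>w. g (fst w) * f (burnside_step w) \<partial>joint)"
proof -
  have half_way: "(\<integral>w. poly p (fst w) * g (burnside_step w) \<partial>joint) = (\<integral>w. g (fst w) * poly p (burnside_step w) \<partial>joint)" for p
  proof -
    obtain q where "(\<lambda>n. \<integral>x. (g x - poly (q n) x)\<^sup>2 \<partial>stat) \<longlonglongrightarrow> 0"
      by (rule stat.poly_dense_sequence[OF g])
    note lim = tendsto_joint_correlation[OF g stat.poly_square_integrable this, of p]
    show ?thesis
      by (rule LIMSEQ_unique[OF lim(2)]) (use lim(1) in \<open>simp add: joint_symmetric_poly\<close>)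
  qed
  obtain p where "(\<lambda>n. \<integral>x. (f x - poly (p n) x)\<^sup>2 \<partial>stat) \<longlonglongrightarrow> 0"
    by (rule stat.poly_dense_sequence[OF f])
  note lim = tendsto_joint_correlation[OF f g this]
  show ?thesis
    by (rule LIMSEQ_unique[OF lim(1)]) (use lim(2) in \<open>simp add: half_way\<close>)
qed

lemma emeasure_burnside_kernel:
  assumes "A \<in> sets borel"
  shows "emeasure (burnside_kernel \<theta> x) A = (\<integral>\<^sup>+w. indicator A (burnside_step (x, w)) \<partial>beta_pair \<theta>)"
proof -
  have "(\<lambda>(z, z'). x * z + (1 - x) * z') = (\<lambda>w. burnside_step (x, w))" by auto
  then have "burnside_kernel \<theta> x = distr (beta_pair \<theta>) borel (\<lambda>w. burnside_step (x, w))"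
    unfolding burnside_kernel_def by simp
  moreover have "(\<lambda>w. burnside_step (x, w)) \<in> borel_measurable (beta_pair \<theta>)" by measurable
  ultimately show ?thesis using assms
    by (simp add: nn_integral_distr flip: nn_integral_indicator)
qed

text \<open>
  The two flows are correlations of indicators, which are square integrable.
\<close>

lemma reversible_burnside: "reversible (burnside_kernel \<theta>) stat"
  unfolding reversible_def
proof (intro ballI)
  fix A B assume "A \<in> sets stat" "B \<in> sets stat"
  then have AB [measurable]: "A \<in> sets borel" "B \<in> sets borel" by auto
  have flow: "(\<integral>\<^sup>+x\<in>A. emeasure (burnside_kernel \<theta> x) B \<partial>stat) =
      ennreal (\<integral>w. indicator A (fst w) * indicator B (burnside_step w) \<partial>joint)"
    if [measurable]: "A \<in> sets borel" "B \<in> sets borel" for A B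
  proof -
    have "(\<integral>\<^sup>+x\<in>A. emeasure (burnside_kernel \<theta> x) B \<partial>stat) =
        (\<integral>\<^sup>+x. \<integral>\<^sup>+w. indicator A (fst (x, w)) * indicator B (burnside_step (x, w)) \<partial>beta_pair \<theta> \<partial>stat)"
      by (intro nn_integral_cong) (simp add: emeasure_burnside_kernel that nn_integral_cmult mult.commute)
    also have "\<dots> = (\<integral>\<^sup>+w. indicator A (fst w) * indicator B (burnside_step w) \<partial>joint)"
      by (rule pair.nn_integral_fst) measurable
    also have "\<dots> = (\<integral>\<^sup>+w. ennreal (indicator A (fst w) * indicator B (burnside_step w)) \<partial>joint)"
      by (intro nn_integral_cong) (auto simp: indicator_def)
    also have "\<dots> = ennreal (\<integral>w. indicator A (fst w) * indicator B (burnside_step w) \<partial>joint)"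
      by (intro nn_integral_eq_integral joint.integrable_const_bound[where B = 1])
         (auto simp: indicator_def)
    finally show ?thesis .
  qed
  have "square_integrable stat (indicator C)" if "C \<in> sets borel" for C
    using stat.poly_approximable_indicator[OF that] by (simp add: stat.poly_approximable_def)
  then show "(\<integral>\<^sup>+x\<in>A. emeasure (burnside_kernel \<theta> x) B \<partial>stat) = (\<integral>\<^sup>+x\<in>B. emeasure (burnside_kernel \<theta> x) A \<partial>stat)"
    using joint_symmetric[of "indicator A" "indicator B"] AB by (simp add: flow)
qed

lemma stationary_burnside: "stationary_distribution (burnside_kernel \<theta>) stat"
  unfolding stationary_distribution_def
proof (intro conjI ballI)
  show "prob_space stat" by (rule stat.prob_space_axioms)
  fix A assume "A \<in> sets stat"
  then have A [measurable]: "A \<in> sets borel" by simp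
  have "(\<integral>\<^sup>+x. emeasure (burnside_kernel \<theta> x) A \<partial>stat) = (\<integral>\<^sup>+x. \<integral>\<^sup>+w. indicator A (burnside_step (x, w)) \<partial>beta_pair \<theta> \<partial>stat)"
    by (simp add: emeasure_burnside_kernel A)
  also have "\<dots> = (\<integral>\<^sup>+w. indicator A (burnside_step w) \<partial>joint)"
    by (rule pair.nn_integral_fst) measurable
  also have "\<dots> = (\<integral>\<^sup>+x. indicator A x \<partial>distr joint borel burnside_step)"
    by (subst nn_integral_distr) auto
  finally show "(\<integral>\<^sup>+x. emeasure (burnside_kernel \<theta> x) A \<partial>stat) = emeasure stat A"
    by (simp add: distr_joint_burnside_step)
qed

end

section \<open>The Markov operator\<close>

context burnside_chain
begin

abbreviation Kop :: "(real \<Rightarrow> real) \<Rightarrow> real \<Rightarrow> real" where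
  "Kop \<equiv> markov_operator (burnside_kernel \<theta>)"

lemma Kop_inner:
  assumes f: "square_integrable stat f" and g: "square_integrable stat g"
  shows "(\<integral>x. f x * Kop g x \<partial>stat) = (\<integral>w. f (fst w) * g (burnside_step w) \<partial>joint)"
proof -
  have "integrable joint (\<lambda>w. f (fst w) * g (burnside_step w))"
    by (rule square_integrable_mult[OF square_integrable_joint_fst[OF f] square_integrable_joint_step[OF g]])
  from joint.integral_fst'[OF this] show ?thesis
    by (simp add: markov_operator_burnside[OF measurable_stat_borel[OF g]])
qed

lemma Kop_self_adjoint:
  assumes f: "square_integrable stat f" and g: "square_integrable stat g"
  shows "(\<integral>x. Kop f x * g x \<partial>stat) = (\<integral>x. f x * Kop g x \<partial>stat)"
  using Kop_inner[OF f g] Kop_inner[OF g f] joint_symmetric[OF f g] by (simp add: mult.commute)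

lemma Kop_cong_AE:
  assumes fg [measurable]: "f \<in> borel_measurable borel" "g \<in> borel_measurable borel"
    and eq: "AE x in stat. f x = g x"
  shows "AE x in stat. Kop f x = Kop g x"
proof -
  have "AE w in joint. f (burnside_step w) = g (burnside_step w)"
  proof (rule AE_distrD[where f = burnside_step and M' = borel and P = "\<lambda>y. f y = g y"])
    show "AE y in distr joint borel burnside_step. f y = g y"
      unfolding distr_joint_burnside_step by (rule eq)
  qed measurable
  from joint.AE_pair[OF this] show ?thesis
    unfolding markov_operator_burnside[OF fg(1)] markov_operator_burnside[OF fg(2)]
    by eventually_elim (intro integral_cong_AE, auto)
qed

lemma integrable_joint_step:
  assumes "square_integrable stat f"
  shows "integrable joint (\<lambda>w. f (burnside_step w))"
  using joint.square_integrable_abs_integral(1)[OF square_integrable_joint_step[OF assms]] .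

lemma Kop_diff_AE:
  assumes f: "square_integrable stat f" and g: "square_integrable stat g"
  shows "AE x in stat. Kop (\<lambda>y. f y - g y) x = Kop f x - Kop g x"
proof -
  note meas = measurable_stat_borel[OF f] measurable_stat_borel[OF g]
    measurable_stat_borel[OF square_integrable_diff[OF f g]]
  show ?thesis
    using joint.AE_integrable_fst'[OF integrable_joint_step[OF f]]
      joint.AE_integrable_fst'[OF integrable_joint_step[OF g]]
    unfolding markov_operator_burnside[OF meas(1)] markov_operator_burnside[OF meas(2)]
      markov_operator_burnside[OF meas(3)]
    by eventually_elim simp
qed

text \<open>
  The contraction in \<open>L\<^sup>1\<close> follows from stationarity. It controls \<open>Kop f\<close> by mean square approximations of \<open>f\<close>,
  because on a probability space the norm of \<open>L\<^sup>1\<close> is at most that of \<open>L\<^sup>2\<close>.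
\<close>

lemma Kop_L1_contraction:
  assumes f: "square_integrable stat f"
  shows "integrable stat (Kop f)" "(\<integral>x. \<bar>Kop f x\<bar> \<partial>stat) \<le> (\<integral>x. \<bar>f x\<bar> \<partial>stat)"
proof -
  have [measurable]: "f \<in> borel_measurable borel" by (rule measurable_stat_borel[OF f])
  note int = integrable_joint_step[OF f]
  have int': "integrable joint (\<lambda>w. \<bar>f (burnside_step w)\<bar>)" using int by simp
  have Kop: "Kop f = (\<lambda>x. \<integral>w. f (burnside_step (x, w)) \<partial>beta_pair \<theta>)"
    by (rule ext, rule markov_operator_burnside) measurable
  show i: "integrable stat (Kop f)" unfolding Kop by (rule joint.integrable_fst'[OF int])
  have "(\<integral>x. \<bar>Kop f x\<bar> \<partial>stat) \<le> (\<integral>x. (\<integral>w. \<bar>f (burnside_step (x, w))\<bar> \<partial>beta_pair \<theta>) \<partial>stat)"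
  proof (rule integral_mono)
    show "integrable stat (\<lambda>x. \<bar>Kop f x\<bar>)" using i by simp
    show "integrable stat (\<lambda>x. \<integral>w. \<bar>f (burnside_step (x, w))\<bar> \<partial>beta_pair \<theta>)"
      by (rule joint.integrable_fst'[OF int'])
    show "\<bar>Kop f x\<bar> \<le> (\<integral>w. \<bar>f (burnside_step (x, w))\<bar> \<partial>beta_pair \<theta>)" for x
      unfolding Kop by (rule integral_abs_bound)
  qed
  also have "\<dots> = (\<integral>w. \<bar>f (burnside_step w)\<bar> \<partial>joint)" by (rule joint.integral_fst'[OF int'])
  also have "\<dots> = (\<integral>x. \<bar>f x\<bar> \<partial>stat)" by (rule integral_joint_step) measurable
  finally show "(\<integral>x. \<bar>Kop f x\<bar> \<partial>stat) \<le> (\<integral>x. \<bar>f x\<bar> \<partial>stat)" .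
qed

text \<open>
  It will turn out that these are the eigenvalues, the \<open>n\<close>-th one belonging to the Jacobi polynomial of
  degree \<open>n\<close>.
\<close>

definition difference_moment :: "nat \<Rightarrow> real" where
  "difference_moment n = (\<integral>(z, z'). (z - z') ^ n \<partial>beta_pair \<theta>)"

lemma power_diff_binomial:
  "(case w of (z, z') \<Rightarrow> (z - z') ^ n) = (\<Sum>j\<le>n. real (n choose j) * (-1) ^ (n - j) * (fst w ^ j * snd w ^ (n - j)))"
proof -
  have "(z - z') ^ n = (\<Sum>j\<le>n. real (n choose j) * (-1) ^ (n - j) * (z ^ j * z' ^ (n - j)))" for z z' :: real
    using binomial_ring[of z "- z'" n] by (simp add: power_minus[of z'] mult_ac)
  then show ?thesis by (simp add: case_prod_beta)
qed

lemma difference_moment_binomial: "difference_moment n = (\<Sum>j\<le>n. real (n choose j) * (-1) ^ (n - j) * (half_moment j * half_moment (n - j)))"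
  unfolding difference_moment_def power_diff_binomial using beta_pair_monomial by simp

lemma integrable_power_diff: "integrable (beta_pair \<theta>) (\<lambda>(z, z'). (z - z') ^ n)"
  unfolding power_diff_binomial[abs_def] using beta_pair_monomial(1) by auto

lemma difference_moment_0: "difference_moment 0 = 1"
  by (simp add: difference_moment_binomial)

text \<open>
  Exchanging the independent and identically distributed variables changes the sign of an odd power
  of their difference.
\<close>

lemma difference_moment_odd:
  assumes "odd n"
  shows "difference_moment n = 0"
proof -
  have "difference_moment n = (\<integral>(z, z'). (z' - z) ^ n \<partial>beta_pair \<theta>)"
    unfolding difference_moment_def beta_pair_def
    using halves.integral_product_swap[of "\<lambda>(z, z'). (z - z') ^ n"] by (simp add: case_prod_beta)
  also have "\<dots> = (\<integral>w. - (case w of (z, z') \<Rightarrow> (z - z') ^ n) \<partial>beta_pair \<theta>)"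
  proof (intro Bochner_Integration.integral_cong refl)
    fix w :: "real \<times> real"
    show "(case w of (z, z') \<Rightarrow> (z' - z) ^ n) = - (case w of (z, z') \<Rightarrow> (z - z') ^ n)"
      using power_minus_odd[OF assms, of "fst w - snd w"] by (simp add: case_prod_beta)
  qed
  also have "\<dots> = - difference_moment n" by (simp add: difference_moment_def)
  finally show ?thesis by simp
qed

lemma AE_beta_pair_difference: "AE w in beta_pair \<theta>. 0 < (fst w - snd w)\<^sup>2 \<and> (fst w - snd w)\<^sup>2 < 1"
  unfolding beta_pair_def
proof (rule halves.AE_pair_measure)
  show "AE x in half. AE y in half. 0 < (fst (x, y) - snd (x, y))\<^sup>2 \<and> (fst (x, y) - snd (x, y))\<^sup>2 < 1"
    using half.AE_unit half.no_atoms[of 0] half.no_atoms[of 1]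
  proof eventually_elim
    case (elim x)
    show ?case
      using half.AE_unit half.no_atoms[of x]
    proof eventually_elim
      case (elim y)
      then have "\<bar>x - y\<bar> < 1" using \<open>0 \<le> x \<and> x \<le> 1\<close> \<open>x \<noteq> 0\<close> \<open>x \<noteq> 1\<close> by auto
      with elim show ?case by (simp add: abs_square_less_1)
    qed
  qed
qed measurable

lemma difference_moment_even_pos: "difference_moment (2 * k) > 0"
proof -
  have "(\<integral>w. 0 \<partial>beta_pair \<theta>) < (\<integral>w. (case w of (z, z') \<Rightarrow> (z - z') ^ (2 * k)) \<partial>beta_pair \<theta>)"
  proof (rule pair.integral_less_AE_space)
    show "AE w in beta_pair \<theta>. 0 < (case w of (z, z') \<Rightarrow> (z - z') ^ (2 * k))"
      using AE_beta_pair_difference by eventually_elim (simp add: case_prod_beta power_mult)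
    show "emeasure (beta_pair \<theta>) (space (beta_pair \<theta>)) \<noteq> 0" using pair.emeasure_space_1 by simp
  qed (use integrable_power_diff in auto)
  then show ?thesis by (simp add: difference_moment_def)
qed

text \<open>
  Almost surely \<open>0 < (z - z')\<^sup>2 < 1\<close>, so the powers of this square decrease strictly. Hence all nonzero
  eigenvalues are distinct, and each belongs to a single degree.
\<close>

lemma difference_moment_even_strictly_decreasing:
  assumes "i < j"
  shows "difference_moment (2 * j) < difference_moment (2 * i)"
proof -
  have "difference_moment (2 * Suc k) < difference_moment (2 * k)" for k
    unfolding difference_moment_def
  proof (rule pair.integral_less_AE_space)
    show "AE w in beta_pair \<theta>. (case w of (z, z') \<Rightarrow> (z - z') ^ (2 * Suc k)) < (case w of (z, z') \<Rightarrow> (z - z') ^ (2 * k))"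
      using AE_beta_pair_difference
    proof eventually_elim
      case (elim w)
      then have "((fst w - snd w)\<^sup>2) ^ Suc k < ((fst w - snd w)\<^sup>2) ^ k"
        by (intro power_strict_decreasing) auto
      then show ?case by (simp only: case_prod_beta power_mult)
    qed
    show "emeasure (beta_pair \<theta>) (space (beta_pair \<theta>)) \<noteq> 0" using pair.emeasure_space_1 by simp
  qed (rule integrable_power_diff)+
  then show ?thesis using lift_Suc_mono_less[of "\<lambda>k. - difference_moment (2 * k)", OF _ assms] by simp
qed

lemma difference_moment_eq_even_iff: "difference_moment m = difference_moment (2 * k) \<longleftrightarrow> m = 2 * k"
proof
  assume eq: "difference_moment m = difference_moment (2 * k)"
  then have "even m" using difference_moment_odd[of m] difference_moment_even_pos[of k] by force
  then obtain j where "m = 2 * j" by blast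
  then show "m = 2 * k"
    using eq difference_moment_even_strictly_decreasing[of j k] difference_moment_even_strictly_decreasing[of k j]
    by (cases j k rule: linorder_cases) auto
qed simp

section \<open>Action on polynomials\<close>

text \<open>
  Expanding \<open>(x z + (1 - x) z')\<^sup>n\<close> and integrating over \<open>(z, z')\<close> shows that the operator sends
  \<open>x\<^sup>n\<close> to the polynomial below, of degree at most \<open>n\<close>. So the operator is triangular in the monomial
  basis, and its diagonal entries can be read off.
\<close>

definition kernel_monomial :: "nat \<Rightarrow> real poly" where
  "kernel_monomial n = (\<Sum>j\<le>n. smult (real (n choose j) * (half_moment j * half_moment (n - j)))
                                  (monom 1 j * [:1, -1:] ^ (n - j)))"

definition kernel_poly :: "real poly \<Rightarrow> real poly" where
  "kernel_poly p = (\<Sum>n\<le>degree p. smult (coeff p n) (kernel_monomial n))"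

lemma poly_kernel_monomial: "poly (kernel_monomial n) x = (\<integral>w. burnside_step (x, w) ^ n \<partial>beta_pair \<theta>)"
  unfolding integral_burnside_step_power kernel_monomial_def
  by (simp add: poly_sum poly_monom mult_ac)

lemma Kop_poly: "Kop (poly p) x = poly (kernel_poly p) x"
proof -
  have "Kop (poly p) x = (\<integral>w. (\<Sum>n\<le>degree p. coeff p n * burnside_step (x, w) ^ n) \<partial>beta_pair \<theta>)"
    by (subst markov_operator_burnside) (auto simp: poly_altdef)
  then show ?thesis
    using integrable_burnside_step_power by (simp add: kernel_poly_def poly_sum poly_kernel_monomial)
qed

lemma degree_kernel_monomial: "degree (kernel_monomial n) \<le> n"
  unfolding kernel_monomial_def
proof (intro degree_sum_le order_trans[OF degree_smult_le] finite_atMost)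
  fix j assume "j \<in> {..n}"
  moreover have "degree ([:1, -1:] ^ (n - j) :: real poly) \<le> n - j"
    using degree_power_le[of "[:1, -1 :: real:]" "n - j"] by simp
  ultimately show "degree (monom 1 j * [:1, -1:] ^ (n - j) :: real poly) \<le> n"
    using degree_mult_le[of "monom 1 j" "[:1, -1 :: real:] ^ (n - j)"] degree_monom_le[of "1::real" j]
    by auto
qed

lemma lead_coeff_kernel_monomial: "coeff (kernel_monomial n) n = difference_moment n"
proof -
  have "coeff ([:1, -1:] ^ k :: real poly) k = (-1) ^ k" for k
    using lead_coeff_power[of "[:1, -1 :: real:]" k] by (simp add: degree_power_eq)
  then show ?thesis
    unfolding kernel_monomial_def difference_moment_binomial coeff_sum
    by (intro sum.cong) (auto simp: coeff_monom_mult)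
qed

lemma degree_kernel_poly: "degree (kernel_poly p) \<le> degree p"
  unfolding kernel_poly_def
  by (intro degree_sum_le order_trans[OF degree_smult_le] finite_atMost order_trans[OF degree_kernel_monomial]) auto

lemma lead_coeff_kernel_poly: "coeff (kernel_poly p) (degree p) = difference_moment (degree p) * coeff p (degree p)"
proof -
  have "coeff (kernel_poly p) (degree p) = (\<Sum>n\<le>degree p. if n = degree p then difference_moment n * coeff p n else 0)"
    unfolding kernel_poly_def coeff_sum
  proof (intro sum.cong refl)
    fix n assume "n \<in> {..degree p}"
    then show "coeff (smult (coeff p n) (kernel_monomial n)) (degree p) = (if n = degree p then difference_moment n * coeff p n else 0)"
      using degree_kernel_monomial[of n] lead_coeff_kernel_monomial
      by (auto simp: coeff_eq_0)
  qed
  then show ?thesis by simp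
qed

abbreviation J :: "nat \<Rightarrow> real poly" where "J \<equiv> jacobi_poly \<theta>"

lemmas J_orthogonal = orthogonal_polynomials_jacobi_poly[OF \<theta>_pos]
lemmas degree_J = degree_jacobi_poly[OF \<theta>_pos]

text \<open>
  The difference \<open>r\<close> of the two sides has degree below \<open>n\<close> by triangularity. For every \<open>g\<close> of degree below
  \<open>n\<close>, self-adjointness moves the operator from \<open>J n\<close> to \<open>g\<close>, whose image again has degree below \<open>n\<close>, so
  \<open>r\<close> is orthogonal to \<open>g\<close>. The choice \<open>g = r\<close> gives \<open>r = 0\<close>.
\<close>

lemma kernel_poly_J: "kernel_poly (J n) = smult (difference_moment n) (J n)"
proof -
  define r where "r = kernel_poly (J n) - smult (difference_moment n) (J n)"
  have "coeff r n = 0"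
    using lead_coeff_kernel_poly[of "J n"] by (simp add: r_def degree_J)
  moreover have "degree r \<le> n"
    using degree_kernel_poly[of "J n"] unfolding r_def degree_J
    by (intro degree_diff_le order_trans[OF degree_smult_le]) (simp_all add: degree_J)
  ultimately have "r = 0 \<or> degree r < n" using eq_zero_or_degree_less by metis
  then have "r = 0"
  proof
    assume deg: "degree r < n"
    have "(\<integral>x. poly (kernel_poly (J n)) x * poly r x \<partial>stat) = (\<integral>x. poly (J n) x * poly (kernel_poly r) x \<partial>stat)"
      using Kop_self_adjoint[OF stat.poly_square_integrable stat.poly_square_integrable, of "J n" r]
      by (simp add: Kop_poly)
    also have "\<dots> = 0"
      using degree_kernel_poly[of r] deg by (intro stat.orthogonal_to_lower_degree[OF J_orthogonal]) simp
    finally have 1: "(\<integral>x. poly (kernel_poly (J n)) x * poly r x \<partial>stat) = 0" .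
    have "(\<integral>x. poly r x * poly r x \<partial>stat) =
        (\<integral>x. poly (kernel_poly (J n)) x * poly r x - difference_moment n * (poly (J n) x * poly r x) \<partial>stat)"
      by (intro Bochner_Integration.integral_cong refl) (simp add: r_def algebra_simps)
    also have "\<dots> = 0"
      using 1 stat.orthogonal_to_lower_degree[OF J_orthogonal deg] by simp
    finally show "r = 0" by (rule stat.poly_eq_zero_if_self_orthogonal)
  qed
  then show ?thesis by (simp add: r_def)
qed

lemma Kop_J: "Kop (poly (J n)) x = difference_moment n * poly (J n) x"
  by (simp add: Kop_poly kernel_poly_J)

text \<open>
  The eigenvalue equation is an identity of polynomials and may be evaluated at the point 0, where
  \<open>J n\<close> has the value 1. From 0 the chain moves to \<open>Z'\<close>, so the eigenvalue is the mean of \<open>J n\<close> at a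
  \<open>Beta(\<theta>/2, \<theta>/2)\<close> variable; the moments of the latter turn the coefficients of a \<open>\<^sub>2F\<^sub>1\<close> into those of a
  \<open>\<^sub>3F\<^sub>2\<close> at 1.
\<close>

lemma difference_moment_eq_3F2: "difference_moment n = hypergeometric_3F2 (- real n) (real n + 2 * \<theta> - 1) (\<theta> / 2) \<theta> \<theta> 1"
proof -
  let ?t = "\<lambda>l. pochhammer (- real n) l * pochhammer (real n + 2 * \<theta> - 1) l * pochhammer (\<theta> / 2) l /
           (pochhammer \<theta> l * pochhammer \<theta> l) * (1 ^ l / fact l)"
  have coeff_J: "coeff (J n) l = (if l \<le> n then pochhammer (- real n) l * pochhammer (real n + 2 * \<theta> - 1) l /
      (pochhammer \<theta> l * fact l) else 0)" for l
    by (simp add: jacobi_poly_def coeff_sum)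
  have J0: "poly (J n) 0 = 1" by (simp add: poly_0_coeff_0 coeff_J)
  have mono0: "poly (kernel_monomial l) 0 = half_moment l" for l
  proof -
    have "poly (kernel_monomial l) 0 = (\<Sum>j\<le>l. if j = 0 then half_moment l else 0)"
      unfolding kernel_monomial_def poly_sum by (intro sum.cong) (auto simp: poly_monom power_0_left)
    then show ?thesis by simp
  qed
  have "difference_moment n = poly (kernel_poly (J n)) 0" by (simp add: kernel_poly_J J0)
  also have "\<dots> = (\<Sum>l\<le>n. coeff (J n) l * half_moment l)"
    by (simp add: kernel_poly_def poly_sum mono0 degree_J)
  also have "\<dots> = (\<Sum>l\<le>n. ?t l)"
    by (intro sum.cong) (simp_all add: coeff_J half_moment_def)
  also have "\<dots> = (\<Sum>l. ?t l)"
    by (rule suminf_finite[symmetric]) (auto simp: pochhammer_of_nat_eq_0_lemma)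
  finally show ?thesis by (simp add: hypergeometric_3F2_def)
qed

lemma burnside_lambda_eq_difference_moment: "burnside_lambda \<theta> k = difference_moment (2 * k)"
  by (simp add: burnside_lambda_def difference_moment_eq_3F2)

section \<open>Eigenvalues and eigenfunctions\<close>

lemma eigenfunction_J:
  assumes "c \<noteq> 0"
  shows "eigenfunction (burnside_kernel \<theta>) stat (difference_moment n) (poly (smult c (J n)))"
  unfolding eigenfunction_def
proof (intro conjI notI stat.poly_square_integrable)
  assume "AE x in stat. poly (smult c (J n)) x = 0"
  then show False using stat.poly_eq_zero_if_AE_zero assms degree_J(1) by (metis smult_eq_0_iff)
next
  have "Kop (poly (smult c (J n))) x = c * Kop (poly (J n)) x" for x
    by (subst (1 2) markov_operator_burnside) auto
  then show "AE x in stat. Kop (poly (smult c (J n))) x = difference_moment n * poly (smult c (J n)) x"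
    by (simp add: Kop_J)
qed

lemma eigenfunction_cong_AE:
  assumes p: "eigenfunction (burnside_kernel \<theta>) stat \<beta> g"
    and f: "f \<in> borel_measurable stat" and eq: "AE x in stat. f x = g x"
  shows "eigenfunction (burnside_kernel \<theta>) stat \<beta> f"
proof -
  have g: "square_integrable stat g" using p by (simp add: eigenfunction_def)
  have eq': "AE x in stat. g x = f x" using eq by eventually_elim simp
  have sf: "square_integrable stat f" by (rule square_integrable_cong_AE[OF g f eq'])
  have "AE x in stat. Kop f x = Kop g x"
    by (rule Kop_cong_AE[OF measurable_stat_borel[OF sf] measurable_stat_borel[OF g] eq])
  moreover have "AE x in stat. Kop g x = \<beta> * g x" using p by (simp add: eigenfunction_def)
  ultimately have "AE x in stat. Kop f x = \<beta> * f x" using eq by eventually_elim simp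
  moreover have "\<not> (AE x in stat. f x = 0)"
  proof
    assume "AE x in stat. f x = 0"
    with eq have "AE x in stat. g x = 0" by eventually_elim simp
    then show False using p by (simp add: eigenfunction_def)
  qed
  ultimately show ?thesis using sf by (simp add: eigenfunction_def)
qed

text \<open>
  Self-adjointness, applied to the inner product of \<open>Kop f\<close> with \<open>J n\<close>. An eigenfunction therefore has
  nonzero Jacobi coefficients only in degrees whose eigenvalue is its own.
\<close>

lemma eigenfunction_coefficient:
  assumes "eigenfunction (burnside_kernel \<theta>) stat \<beta> f"
  shows "(\<beta> - difference_moment n) * (\<integral>x. f x * poly (J n) x \<partial>stat) = 0"
proof -
  have f: "square_integrable stat f" and Kf: "AE x in stat. Kop f x = \<beta> * f x"
    using assms by (auto simp: eigenfunction_def)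
  have [measurable]: "f \<in> borel_measurable borel" by (rule measurable_stat_borel[OF f])
  have [measurable]: "Kop f \<in> borel_measurable stat" using Kop_L1_contraction(1)[OF f] by auto
  have "\<beta> * (\<integral>x. f x * poly (J n) x \<partial>stat) = (\<integral>x. \<beta> * (f x * poly (J n) x) \<partial>stat)"
    by simp
  also have "\<dots> = (\<integral>x. Kop f x * poly (J n) x \<partial>stat)"
  proof (rule integral_cong_AE)
    show "AE x in stat. \<beta> * (f x * poly (J n) x) = Kop f x * poly (J n) x"
      using Kf by eventually_elim simp
  qed measurable
  also have "\<dots> = (\<integral>x. f x * Kop (poly (J n)) x \<partial>stat)"
    by (rule Kop_self_adjoint[OF f stat.poly_square_integrable])
  also have "\<dots> = difference_moment n * (\<integral>x. f x * poly (J n) x \<partial>stat)"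
    by (simp add: Kop_J mult.left_commute[of _ "difference_moment n"])
  finally show ?thesis by (simp add: left_diff_distrib)
qed

lemma eigenvalue_is_difference_moment:
  assumes "eigenvalue (burnside_kernel \<theta>) stat \<beta>"
  shows "\<exists>n. \<beta> = difference_moment n"
proof (rule ccontr)
  assume no: "\<nexists>n. \<beta> = difference_moment n"
  obtain f where f: "eigenfunction (burnside_kernel \<theta>) stat \<beta> f"
    using assms by (auto simp: eigenvalue_def)
  have "AE x in stat. f x = 0"
  proof (rule stat.AE_zero_if_orthogonal_to_basis[OF J_orthogonal])
    show "square_integrable stat f" using f by (simp add: eigenfunction_def)
    show "(\<integral>x. f x * poly (J n) x \<partial>stat) = 0" for n
      using eigenfunction_coefficient[OF f, of n] no by auto
  qed
  with f show False by (simp add: eigenfunction_def)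
qed

lemma nonzero_eigenvalues:
  "{\<beta>. \<beta> \<noteq> 0 \<and> eigenvalue (burnside_kernel \<theta>) stat \<beta>} = range (\<lambda>k. difference_moment (2 * k))"
proof (intro equalityI subsetI)
  fix \<beta> assume "\<beta> \<in> {\<beta>. \<beta> \<noteq> 0 \<and> eigenvalue (burnside_kernel \<theta>) stat \<beta>}"
  then obtain n where "\<beta> = difference_moment n" "\<beta> \<noteq> 0" using eigenvalue_is_difference_moment by auto
  moreover from this have "even n" using difference_moment_odd by blast
  ultimately show "\<beta> \<in> range (\<lambda>k. difference_moment (2 * k))" by (auto elim: evenE)
next
  fix \<beta> assume "\<beta> \<in> range (\<lambda>k. difference_moment (2 * k))"
  then obtain k where "\<beta> = difference_moment (2 * k)" by blast
  then show "\<beta> \<in> {\<beta>. \<beta> \<noteq> 0 \<and> eigenvalue (burnside_kernel \<theta>) stat \<beta>}"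
    using eigenfunction_J[of 1 "2 * k"] difference_moment_even_pos[of k] by (auto simp: eigenvalue_def)
qed

text \<open>
  The eigenvalue occurs in degree \<open>2 k\<close> only, so \<open>f\<close> minus its projection to \<open>J (2 * k)\<close> is orthogonal to
  the whole Jacobi basis and vanishes by completeness.
\<close>

lemma eigenfunction_even_iff:
  "eigenfunction (burnside_kernel \<theta>) stat (difference_moment (2 * k)) f \<longleftrightarrow>
   (\<exists>p. is_jacobi \<theta> (2 * k) p \<and> f \<in> borel_measurable stat \<and> (AE x in stat. f x = poly p x))"
proof
  assume ef: "eigenfunction (burnside_kernel \<theta>) stat (difference_moment (2 * k)) f"
  then have f: "square_integrable stat f" and nz: "\<not> (AE x in stat. f x = 0)"
    by (auto simp: eigenfunction_def)
  define N where "N = (\<integral>x. poly (J (2 * k)) x * poly (J (2 * k)) x \<partial>stat)"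
  have N: "N \<noteq> 0"
    using stat.poly_eq_zero_if_self_orthogonal degree_J(1) unfolding N_def by blast
  define c where "c = (\<integral>x. f x * poly (J (2 * k)) x \<partial>stat) / N"
  have AE: "AE x in stat. f x - poly (smult c (J (2 * k))) x = 0"
  proof (rule stat.AE_zero_if_orthogonal_to_basis[OF J_orthogonal])
    show "square_integrable stat (\<lambda>x. f x - poly (smult c (J (2 * k))) x)"
      by (rule square_integrable_diff[OF f stat.poly_square_integrable])
    fix n
    have "(\<integral>x. (f x - poly (smult c (J (2 * k))) x) * poly (J n) x \<partial>stat) =
        (\<integral>x. f x * poly (J n) x - c * (poly (J (2 * k)) x * poly (J n) x) \<partial>stat)"
      by (intro Bochner_Integration.integral_cong refl) (simp add: algebra_simps)
    also have "\<dots> = (\<integral>x. f x * poly (J n) x \<partial>stat) - c * (\<integral>x. poly (J (2 * k)) x * poly (J n) x \<partial>stat)"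
      using stat.integrable_mult_poly[OF f] by simp
    also have "\<dots> = 0"
    proof (cases "n = 2 * k")
      case True
      then show ?thesis using N by (simp add: c_def N_def)
    next
      case False
      then have "difference_moment n \<noteq> difference_moment (2 * k)" by (simp add: difference_moment_eq_even_iff)
      then have "(\<integral>x. f x * poly (J n) x \<partial>stat) = 0"
        using eigenfunction_coefficient[OF ef, of n] by auto
      then show ?thesis using J_orthogonal False by (simp add: orthogonal_polynomials_def)
    qed
    finally show "(\<integral>x. (f x - poly (smult c (J (2 * k))) x) * poly (J n) x \<partial>stat) = 0" .
  qed
  have "c \<noteq> 0" using AE nz by auto
  then have "is_jacobi \<theta> (2 * k) (smult c (J (2 * k)))"
    using is_jacobi_iff[OF \<theta>_pos] by blast
  moreover have "AE x in stat. f x = poly (smult c (J (2 * k))) x"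
    using AE by eventually_elim simp
  ultimately show "\<exists>p. is_jacobi \<theta> (2 * k) p \<and> f \<in> borel_measurable stat \<and> (AE x in stat. f x = poly p x)"
    using f by (auto simp: square_integrable_def)
next
  assume "\<exists>p. is_jacobi \<theta> (2 * k) p \<and> f \<in> borel_measurable stat \<and> (AE x in stat. f x = poly p x)"
  then obtain c where "c \<noteq> 0" "f \<in> borel_measurable stat" "AE x in stat. f x = poly (smult c (J (2 * k))) x"
    unfolding is_jacobi_iff[OF \<theta>_pos] by blast
  then show "eigenfunction (burnside_kernel \<theta>) stat (difference_moment (2 * k)) f"
    by (intro eigenfunction_cong_AE[OF eigenfunction_J])
qed

lemma eigenfunction_1_iff:
  "eigenfunction (burnside_kernel \<theta>) stat 1 f \<longleftrightarrow>
   (\<exists>c. c \<noteq> 0 \<and> f \<in> borel_measurable stat \<and> (AE x in stat. f x = c))"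
proof -
  have "J 0 = 1" by (simp add: jacobi_poly_def monom_0 one_pCons)
  then show ?thesis
    using eigenfunction_even_iff[of 0 f] is_jacobi_iff[OF \<theta>_pos, of 0] by (auto simp: difference_moment_0)
qed

lemma eigenfunction_odd:
  assumes "odd n" "is_jacobi \<theta> n p"
  shows "eigenfunction (burnside_kernel \<theta>) stat 0 (poly p)"
  using eigenfunction_J[of _ n] assms is_jacobi_iff[OF \<theta>_pos, of n p] difference_moment_odd[of n] by auto

lemma Kop_odd_sum:
  assumes "finite T" "T \<subseteq> {p. \<exists>n. odd n \<and> is_jacobi \<theta> n p}"
  shows "Kop (\<lambda>x. \<Sum>p\<in>T. c p * poly p x) x = 0"
proof -
  have int: "integrable (beta_pair \<theta>) (\<lambda>w. poly p (burnside_step (x, w)))" for p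
    unfolding poly_altdef using integrable_burnside_step_power by auto
  have "Kop (\<lambda>x. \<Sum>p\<in>T. c p * poly p x) x = (\<integral>w. (\<Sum>p\<in>T. c p * poly p (burnside_step (x, w))) \<partial>beta_pair \<theta>)"
    by (rule markov_operator_burnside) measurable
  also have "\<dots> = (\<Sum>p\<in>T. c p * Kop (poly p) x)"
    using int by (subst markov_operator_burnside) simp_all
  also have "\<dots> = 0"
  proof (intro sum.neutral ballI)
    fix p assume "p \<in> T"
    then obtain n d where "odd n" "p = smult d (J n)"
      using assms(2) is_jacobi_iff[OF \<theta>_pos] by blast
    then have "Kop (poly p) x = d * Kop (poly (J n)) x"
      by (subst (1 2) markov_operator_burnside) auto
    then show "c p * Kop (poly p) x = 0"
      using Kop_J[of n x] difference_moment_odd[OF \<open>odd n\<close>] by simp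
  qed
  finally show ?thesis .
qed

text \<open>
  Finite combinations of Jacobi polynomials of odd degree are annihilated exactly, so subtracting one
  of them from \<open>f\<close> leaves \<open>Kop f\<close> unchanged while the remainder is as small as desired.
\<close>

lemma Kop_zero_if_in_odd_span:
  assumes span: "in_closed_span stat {p. \<exists>n. odd n \<and> is_jacobi \<theta> n p} f"
  shows "AE x in stat. Kop f x = 0"
proof -
  have f: "square_integrable stat f" using span by (simp add: in_closed_span_def)
  note K = Kop_L1_contraction
  have small: "(\<integral>x. \<bar>Kop f x\<bar> \<partial>stat)\<^sup>2 < e" if "e > 0" for e
  proof -
    from in_closed_span_def[THEN iffD1, OF span, THEN conjunct2, rule_format, OF that]
    obtain T c where T: "finite T" "T \<subseteq> {p. \<exists>n. odd n \<and> is_jacobi \<theta> n p}"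
      and close: "(\<integral>x. (f x - (\<Sum>p\<in>T. c p * poly p x))\<^sup>2 \<partial>stat) < e"
      by (elim exE conjE)
    define s where "s = (\<lambda>x. \<Sum>p\<in>T. c p * poly p x)"
    have s: "square_integrable stat s"
      unfolding s_def by (intro stat.continuous_square_integrable continuous_intros)
    note fs = square_integrable_diff[OF f s]
    have "AE x in stat. Kop (\<lambda>y. f y - s y) x = Kop f x"
      using Kop_diff_AE[OF f s] by eventually_elim (simp add: s_def Kop_odd_sum[OF T])
    then have "AE x in stat. \<bar>Kop f x\<bar> = \<bar>Kop (\<lambda>y. f y - s y) x\<bar>" by eventually_elim simp
    then have "(\<integral>x. \<bar>Kop f x\<bar> \<partial>stat) = (\<integral>x. \<bar>Kop (\<lambda>y. f y - s y) x\<bar> \<partial>stat)"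
      by (intro integral_cong_AE) (use K(1)[OF f] K(1)[OF fs] in auto)
    also have "\<dots> \<le> (\<integral>x. \<bar>f x - s x\<bar> \<partial>stat)" by (rule K(2)[OF fs])
    finally have "(\<integral>x. \<bar>Kop f x\<bar> \<partial>stat)\<^sup>2 \<le> (\<integral>x. \<bar>f x - s x\<bar> \<partial>stat)\<^sup>2"
      by (intro power_mono) auto
    also have "\<dots> \<le> (\<integral>x. (f x - s x)\<^sup>2 \<partial>stat)"
      by (rule stat.square_integrable_abs_integral(2)[OF fs])
    finally show ?thesis using close by (simp add: s_def)
  qed
  have "(\<integral>x. \<bar>Kop f x\<bar> \<partial>stat) = 0"
    using small[of "(\<integral>x. \<bar>Kop f x\<bar> \<partial>stat)\<^sup>2"] by (meson less_irrefl zero_less_power2)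
  then show ?thesis
    using integral_nonneg_eq_0_iff_AE[of stat "\<lambda>x. \<bar>Kop f x\<bar>"] K(1)[OF f] by simp
qed

text \<open>
  A function that is annihilated has no Jacobi components of even degree, since there the eigenvalues
  are positive; hence it lies in the closed span of the odd degrees. The converse is the previous lemma.
\<close>

lemma eigenfunction_0_iff:
  "eigenfunction (burnside_kernel \<theta>) stat 0 f \<longleftrightarrow>
   in_closed_span stat {p. \<exists>n. odd n \<and> is_jacobi \<theta> n p} f \<and> \<not> (AE x in stat. f x = 0)"
proof
  assume ef: "eigenfunction (burnside_kernel \<theta>) stat 0 f"
  then have f: "square_integrable stat f" by (simp add: eigenfunction_def)
  have "in_closed_span stat (J ` {n. odd n}) f"
  proof (rule stat.in_closed_span_if_orthogonal_to_rest[OF J_orthogonal f])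
    fix n :: nat assume "n \<notin> {n. odd n}"
    then obtain k where "n = 2 * k" by auto
    then show "(\<integral>x. f x * poly (J n) x \<partial>stat) = 0"
      using eigenfunction_coefficient[OF ef, of n] difference_moment_even_pos[of k] by auto
  qed
  moreover have "J ` {n. odd n} \<subseteq> {p. \<exists>n. odd n \<and> is_jacobi \<theta> n p}"
    using J_orthogonal by (auto simp: is_jacobi_def)
  ultimately have "in_closed_span stat {p. \<exists>n. odd n \<and> is_jacobi \<theta> n p} f"
    unfolding in_closed_span_def by (meson subset_trans)
  then show "in_closed_span stat {p. \<exists>n. odd n \<and> is_jacobi \<theta> n p} f \<and> \<not> (AE x in stat. f x = 0)"
    using ef by (simp add: eigenfunction_def)
next
  assume "in_closed_span stat {p. \<exists>n. odd n \<and> is_jacobi \<theta> n p} f \<and> \<not> (AE x in stat. f x = 0)"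
  then show "eigenfunction (burnside_kernel \<theta>) stat 0 f"
    using Kop_zero_if_in_odd_span[of f] by (simp add: eigenfunction_def in_closed_span_def)
qed

end

theorem theorem6p1:
  fixes \<theta> :: real
  assumes "\<theta> > 0"
  defines "K \<equiv> burnside_kernel \<theta>"
    and "\<pi> \<equiv> beta_distribution \<theta> \<theta>"
  shows "reversible K \<pi> \<and> stationary_distribution K \<pi> \<and>
    {\<beta>. \<beta> \<noteq> 0 \<and> eigenvalue K \<pi> \<beta>} = {1} \<union> {burnside_lambda \<theta> k | k. k \<ge> 1} \<and>
    (\<forall>k\<ge>1. burnside_lambda \<theta> k = (\<integral>(z, z'). (z - z') ^ (2 * k) \<partial>beta_pair \<theta>)) \<and>
    (\<forall>f. eigenfunction K \<pi> 1 f \<longleftrightarrow> (\<exists>c. c \<noteq> 0 \<and> f \<in> borel_measurable \<pi> \<and> (AE x in \<pi>. f x = c))) \<and>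
    (\<forall>n p. odd n \<and> is_jacobi \<theta> n p \<longrightarrow> eigenfunction K \<pi> 0 (poly p)) \<and>
    (\<forall>f. eigenfunction K \<pi> 0 f \<longleftrightarrow>
       in_closed_span \<pi> {p. \<exists>n. odd n \<and> is_jacobi \<theta> n p} f \<and> \<not> (AE x in \<pi>. f x = 0)) \<and>
    (\<forall>k\<ge>1. \<forall>f. eigenfunction K \<pi> (burnside_lambda \<theta> k) f \<longleftrightarrow>
       (\<exists>p. is_jacobi \<theta> (2 * k) p \<and> f \<in> borel_measurable \<pi> \<and> (AE x in \<pi>. f x = poly p x)))"
proof -
  interpret burnside_chain \<theta> by unfold_locales fact
  have "range (\<lambda>k. difference_moment (2 * k)) = {1} \<union> {burnside_lambda \<theta> k | k. k \<ge> 1}"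
  proof -
    have "range (\<lambda>k. difference_moment (2 * k)) = (\<lambda>k. difference_moment (2 * k)) ` ({0} \<union> {1..})"
      by (intro arg_cong[where f = "image _"]) force
    then show ?thesis by (auto simp: burnside_lambda_eq_difference_moment difference_moment_0)
  qed
  then have spectrum: "{\<beta>. \<beta> \<noteq> 0 \<and> eigenvalue K \<pi> \<beta>} = {1} \<union> {burnside_lambda \<theta> k | k. k \<ge> 1}"
    using nonzero_eigenvalues by (simp add: K_def \<pi>_def)
  show ?thesis
    unfolding spectrum unfolding K_def \<pi>_def burnside_lambda_eq_difference_moment
    by (intro conjI allI impI refl reversible_burnside stationary_burnside eigenfunction_1_iff
          eigenfunction_0_iff eigenfunction_even_iff difference_moment_def) (auto intro: eigenfunction_odd)
qed

end
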